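(* Let $\mathcal{A}$ be the operator on the Hilbert space $\mathcal{H}$ defined in the context, and let $U_0=[u^1_0,v^1_0,\theta_0,q_0,u^2_0,v^2_0]'\in\mathcal{H}$ be arbitrary. Then $$\int_{L_1}^{L_2}\theta_0\,dx+m\left(u^1_0(L_2)-u^1_0(L_1)\right)=0\iff U_0\in\operatorname{range}(\mathcal{A}).$$
   Context: Fix real numbers $0<L_1<L_2<L_3$ and $a,b,m,k,\tau>0$. Put $I=(L_1,L_2)$ and $J=(0,L_1)\cup(L_2,L_3)$. All functions are complex valued; $H^s(J)$ consists of functions that are $H^s$ on each of the two components of $J$ separately, and point values of functions on $J$ at $0,L_1,L_2,L_3$ are the one-sided traces from within $J$. State space: $\mathcal{H}$ is the set of $[u^1,v^1,\theta,q,u^2,v^2]'\in H^1(I)\times H^1(J)\times L^2(I)\times L^2(I)\times L^2(I)\times L^2(J)$ with $v^1(0)=v^1(L_3)=0$ and $u^1(L_i)=v^1(L_i)$ for $i=1,2$, with inner product $$\langle U,\tilde U\rangle_{\mathcal{H}}=\int_I\left(a u^1_x\overline{\tilde u^1_x}+u^2\overline{\tilde u^2}+\theta\overline{\tilde\theta}+\tau q\overline{\tilde q}\right)dx+\int_J\left(b v^1_x\overline{\tilde v^1_x}+v^2\overline{\tilde v^2}\right)dx ,$$ which makes it a Hilbert space. Operator: $D(\mathcal{A})$ is the set of $U\in\mathcal{H}$ with $u^1\in H^2(I)$, $v^1\in H^2(J)$, $\theta,q,u^2\in H^1(I)$, $v^2\in H^1(J)$, $u^2(L_i)=v^2(L_i)$,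 $v^2(0)=v^2(L_3)=0$, $au^1_x(L_i)-m\theta(L_i)=bv^1_x(L_i)$, $q(L_i)=0$ for $i=1,2$, and $$\mathcal{A}U=\left[u^2,\ v^2,\ -(kq+mu^2)_x,\ -\tfrac{k}{\tau}\theta_x-\tfrac1\tau q,\ (au^1_x-m\theta)_x,\ bv^1_{xx}\right]'.$$ *)

theory Defs
  imports "HOL-Analysis.Analysis"
begin

text \<open>Elements of the Lebesgue and Sobolev spaces are represented by functions on the real line.
  Only their values on the relevant open set matter, and two functions represent the same element
  iff they agree almost everywhere there.\<close>

definition ae_eq :: "real set \<Rightarrow> (real \<Rightarrow> complex) \<Rightarrow> (real \<Rightarrow> complex) \<Rightarrow> bool" where
  "ae_eq S f g \<longleftrightarrow> (AE x in lebesgue_on S. f x = g x)"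

definition Lsq :: "real set \<Rightarrow> (real \<Rightarrow> complex) set" where
  "Lsq S = {f. f \<in> borel_measurable (lebesgue_on S) \<and>
              integrable (lebesgue_on S) (\<lambda>x. (cmod (f x))\<^sup>2)}"

definition test_functions :: "real set \<Rightarrow> (real \<Rightarrow> complex) set" where
  "test_functions S = {\<phi>. \<phi> C1_differentiable_on UNIV \<and>
     compact (closure {x. \<phi> x \<noteq> 0}) \<and> closure {x. \<phi> x \<noteq> 0} \<subseteq> S}"

text \<open>Weak derivatives are tested against compactly supported \<open>C\<^sup>1\<close> functions, as in Brezis,
  \<^emph>\<open>Functional Analysis, Sobolev Spaces and Partial Differential Equations\<close>, Section 8.2;
  smooth test functions give the same notion.\<close>

definition weak_deriv :: "real set \<Rightarrow> (real \<Rightarrow> complex) \<Rightarrow> (real \<Rightarrow> complex) \<Rightarrow> bool" where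
  "weak_deriv S f g \<longleftrightarrow> f \<in> Lsq S \<and> g \<in> Lsq S \<and>
     (\<forall>\<phi>\<in>test_functions S.
        (LINT x|lebesgue_on S. f x * vector_derivative \<phi> (at x)) =
        - (LINT x|lebesgue_on S. g x * \<phi> x))"

definition H1 :: "real set \<Rightarrow> (real \<Rightarrow> complex) set" where
  "H1 S = {f. \<exists>g. weak_deriv S f g}"

text \<open>The choice is determined almost everywhere on \<open>S\<close> whenever a weak derivative exists.\<close>

definition wderiv :: "real set \<Rightarrow> (real \<Rightarrow> complex) \<Rightarrow> real \<Rightarrow> complex" where
  "wderiv S f = (SOME g. weak_deriv S f g)"

definition H2 :: "real set \<Rightarrow> (real \<Rightarrow> complex) set" where
  "H2 S = {f \<in> H1 S. wderiv S f \<in> H1 S}"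

text \<open>The trace at \<open>x \<in> [c, d]\<close> of a function on \<open>(c, d)\<close> is the value at \<open>x\<close> of its representative
  that is continuous up to the boundary; for \<open>c < d\<close> this representative is unique on \<open>[c, d]\<close>,
  and every \<open>H\<^sup>1\<close> function has one.\<close>

definition bdry_trace :: "real \<Rightarrow> real \<Rightarrow> (real \<Rightarrow> complex) \<Rightarrow> real \<Rightarrow> complex" where
  "bdry_trace c d f x = (SOME g. continuous_on {c..d} g \<and> ae_eq {c<..<d} g f) x"

definition I_dom :: "real \<Rightarrow> real \<Rightarrow> real set" where
  "I_dom L1 L2 = {L1<..<L2}"

definition J_dom :: "real \<Rightarrow> real \<Rightarrow> real \<Rightarrow> real set" where
  "J_dom L1 L2 L3 = {0<..<L1} \<union> {L2<..<L3}"

definition H1_J :: "real \<Rightarrow> real \<Rightarrow> real \<Rightarrow> (real \<Rightarrow> complex) set" where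
  "H1_J L1 L2 L3 = {f. f \<in> H1 {0<..<L1} \<and> f \<in> H1 {L2<..<L3}}"

definition H2_J :: "real \<Rightarrow> real \<Rightarrow> real \<Rightarrow> (real \<Rightarrow> complex) set" where
  "H2_J L1 L2 L3 = {f. f \<in> H2 {0<..<L1} \<and> f \<in> H2 {L2<..<L3}}"

text \<open>One-sided traces from within \<open>J\<close>: at \<open>0\<close> and \<open>L1\<close> from the left component, at \<open>L2\<close> and \<open>L3\<close>
  from the right component.\<close>

definition bdry_trace_J :: "real \<Rightarrow> real \<Rightarrow> real \<Rightarrow> (real \<Rightarrow> complex) \<Rightarrow> real \<Rightarrow> complex" where
  "bdry_trace_J L1 L2 L3 f x = (if x \<le> L1 then bdry_trace 0 L1 f x else bdry_trace L2 L3 f x)"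

record state =
  u1 :: "real \<Rightarrow> complex"
  v1 :: "real \<Rightarrow> complex"
  theta :: "real \<Rightarrow> complex"
  q :: "real \<Rightarrow> complex"
  u2 :: "real \<Rightarrow> complex"
  v2 :: "real \<Rightarrow> complex"

definition state_eq :: "real \<Rightarrow> real \<Rightarrow> real \<Rightarrow> state \<Rightarrow> state \<Rightarrow> bool" where
  "state_eq L1 L2 L3 U W \<longleftrightarrow>
     ae_eq (I_dom L1 L2) (u1 U) (u1 W) \<and>
     ae_eq (J_dom L1 L2 L3) (v1 U) (v1 W) \<and>
     ae_eq (I_dom L1 L2) (theta U) (theta W) \<and>
     ae_eq (I_dom L1 L2) (q U) (q W) \<and>
     ae_eq (I_dom L1 L2) (u2 U) (u2 W) \<and>
     ae_eq (J_dom L1 L2 L3) (v2 U) (v2 W)"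

definition state_space :: "real \<Rightarrow> real \<Rightarrow> real \<Rightarrow> state set" where
  "state_space L1 L2 L3 = {U.
     u1 U \<in> H1 (I_dom L1 L2) \<and> v1 U \<in> H1_J L1 L2 L3 \<and>
     theta U \<in> Lsq (I_dom L1 L2) \<and> q U \<in> Lsq (I_dom L1 L2) \<and>
     u2 U \<in> Lsq (I_dom L1 L2) \<and> v2 U \<in> Lsq (J_dom L1 L2 L3) \<and>
     bdry_trace_J L1 L2 L3 (v1 U) 0 = 0 \<and> bdry_trace_J L1 L2 L3 (v1 U) L3 = 0 \<and>
     (\<forall>x\<in>{L1, L2}. bdry_trace L1 L2 (u1 U) x = bdry_trace_J L1 L2 L3 (v1 U) x)}"

text \<open>The inner product of the state space; it does not enter the definition of the range of the
  operator below.\<close>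

definition state_inner ::
  "real \<Rightarrow> real \<Rightarrow> real \<Rightarrow> real \<Rightarrow> real \<Rightarrow> real \<Rightarrow> state \<Rightarrow> state \<Rightarrow> complex" where
  "state_inner L1 L2 L3 a b \<tau> U W =
     (let I = I_dom L1 L2; J = J_dom L1 L2 L3 in
      (LINT x|lebesgue_on I.
         a *\<^sub>R (wderiv I (u1 U) x * cnj (wderiv I (u1 W) x)) + u2 U x * cnj (u2 W x)
         + theta U x * cnj (theta W x) + \<tau> *\<^sub>R (q U x * cnj (q W x))) +
      (LINT x|lebesgue_on J.
         b *\<^sub>R (wderiv J (v1 U) x * cnj (wderiv J (v1 W) x)) + v2 U x * cnj (v2 W x)))"

definition A_dom :: "real \<Rightarrow> real \<Rightarrow> real \<Rightarrow> real \<Rightarrow> real \<Rightarrow> real \<Rightarrow> state set" where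
  "A_dom L1 L2 L3 a b m = {U \<in> state_space L1 L2 L3.
     u1 U \<in> H2 (I_dom L1 L2) \<and> v1 U \<in> H2_J L1 L2 L3 \<and>
     theta U \<in> H1 (I_dom L1 L2) \<and> q U \<in> H1 (I_dom L1 L2) \<and>
     u2 U \<in> H1 (I_dom L1 L2) \<and> v2 U \<in> H1_J L1 L2 L3 \<and>
     bdry_trace_J L1 L2 L3 (v2 U) 0 = 0 \<and> bdry_trace_J L1 L2 L3 (v2 U) L3 = 0 \<and>
     (\<forall>x\<in>{L1, L2}.
        bdry_trace L1 L2 (u2 U) x = bdry_trace_J L1 L2 L3 (v2 U) x \<and>
        a *\<^sub>R bdry_trace L1 L2 (wderiv (I_dom L1 L2) (u1 U)) x - m *\<^sub>R bdry_trace L1 L2 (theta U) x =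
          b *\<^sub>R bdry_trace_J L1 L2 L3 (wderiv (J_dom L1 L2 L3) (v1 U)) x \<and>
        bdry_trace L1 L2 (q U) x = 0)}"

definition A_op ::
  "real \<Rightarrow> real \<Rightarrow> real \<Rightarrow> real \<Rightarrow> real \<Rightarrow> real \<Rightarrow> real \<Rightarrow> real \<Rightarrow> state \<Rightarrow> state" where
  "A_op L1 L2 L3 a b m k \<tau> U =
     (let I = I_dom L1 L2; J = J_dom L1 L2 L3 in
      \<lparr> u1 = u2 U,
        v1 = v2 U,
        theta = (\<lambda>x. - wderiv I (\<lambda>y. k *\<^sub>R q U y + m *\<^sub>R u2 U y) x),
        q = (\<lambda>x. - (k / \<tau>) *\<^sub>R wderiv I (theta U) x - (1 / \<tau>) *\<^sub>R q U x),
        u2 = wderiv I (\<lambda>y. a *\<^sub>R wderiv I (u1 U) y - m *\<^sub>R theta U y),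
        v2 = (\<lambda>x. b *\<^sub>R wderiv J (wderiv J (v1 U)) x) \<rparr>)"

text \<open>The range consists of all representatives of the elements \<open>A U\<close> with \<open>U\<close> in the domain.\<close>

definition A_range ::
  "real \<Rightarrow> real \<Rightarrow> real \<Rightarrow> real \<Rightarrow> real \<Rightarrow> real \<Rightarrow> real \<Rightarrow> real \<Rightarrow> state set" where
  "A_range L1 L2 L3 a b m k \<tau> = {F \<in> state_space L1 L2 L3.
     \<exists>U\<in>A_dom L1 L2 L3 a b m. state_eq L1 L2 L3 (A_op L1 L2 L3 a b m k \<tau> U) F}"

end

theory Submission
  imports Defs
begin

text \<open>On an interval a weak derivative means being almost everywhere a primitive: testing against
  \<open>C\<^sup>1\<close> approximations of trapezoids and letting them degenerate to the indicator of \<open>(s, t)\<close> gives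
  \<open>f t - f s = \<integral>\<^bsub>s\<^esub>\<^bsup>t\<^esup> g\<close> at Lebesgue points, and the converse is Fubini's theorem.

  If \<open>A U = U\<^sub>0\<close>, integrating \<open>\<theta>\<^sub>0 = -(k q + m u\<^sup>2)\<^sub>x\<close> with \<open>q(L\<^sub>1) = q(L\<^sub>2) = 0\<close> and \<open>u\<^sup>2 = u\<^sup>1\<^sub>0\<close> gives the
  condition. Conversely, integrating \<open>\<theta>\<^sub>0\<close> from \<open>L\<^sub>1\<close> gives a flux \<open>q\<close> with \<open>q(L\<^sub>1) = 0\<close>, and the condition
  says precisely \<open>q(L\<^sub>2) = 0\<close>. The second equation then determines \<open>\<theta>\<close> up to a constant \<open>C\<^sub>0\<close>. Choosing
  \<open>a u\<^sup>1\<^sub>x - m \<theta>\<close> to vanish at \<open>L\<^sub>1\<close>, the transmission conditions for the fluxes fix \<open>v\<^sup>1\<^sub>x\<close>, the outer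
  boundary conditions fix \<open>v\<^sup>1\<close>, and \<open>C\<^sub>0\<close> is what adjusts \<open>u\<^sup>1(L\<^sub>2) - u\<^sup>1(L\<^sub>1)\<close> to
  \<open>v\<^sup>1(L\<^sub>2) - v\<^sup>1(L\<^sub>1)\<close>.\<close>

subsection \<open>Square integrable functions and test functions\<close>

lemma AE_lebesgue_on_iff:
  assumes "S \<in> sets lebesgue"
  shows "(AE x in lebesgue_on S. P x) \<longleftrightarrow> (AE x in lebesgue. x \<in> S \<longrightarrow> P x)"
  using assms by (intro AE_restrict_space_iff) auto

lemma finite_measure_lebesgue_on_bounded:
  assumes "bounded S" "S \<in> sets lebesgue"
  shows "finite_measure (lebesgue_on S)"
  using assms by (intro finite_measure_lebesgue_on) (simp add: bounded_set_imp_lmeasurable)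

lemma integrable_mult_bounded:
  fixes f \<psi> :: "real \<Rightarrow> complex"
  assumes "integrable M f" "\<psi> \<in> borel_measurable M" "\<And>x. x \<in> space M \<Longrightarrow> cmod (\<psi> x) \<le> B"
  shows "integrable M (\<lambda>x. f x * \<psi> x)"
proof (rule Bochner_Integration.integrable_bound)
  show "integrable M (\<lambda>x. B * cmod (f x))"
    using assms(1) by simp
  show "(\<lambda>x. f x * \<psi> x) \<in> borel_measurable M"
    using assms by measurable
  show "AE x in M. cmod (f x * \<psi> x) \<le> norm (B * cmod (f x))"
  proof (rule AE_I2)
    fix x assume "x \<in> space M"
    then have "cmod (\<psi> x) \<le> B" by (rule assms)
    then have "cmod (\<psi> x) \<le> \<bar>B\<bar>" by linarith
    then show "cmod (f x * \<psi> x) \<le> norm (B * cmod (f x))"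
      by (simp add: norm_mult abs_mult mult.commute mult_right_mono)
  qed
qed

lemma Lsq_measurable: "f \<in> Lsq S \<Longrightarrow> f \<in> borel_measurable (lebesgue_on S)"
  by (simp add: Lsq_def)

text \<open>On a bounded set constants are integrable, and \<open>1 + |f|^2\<close> dominates
  \<open>|f|\<close>.\<close>

lemma Lsq_integrable:
  assumes "f \<in> Lsq S" "bounded S" "S \<in> sets lebesgue"
  shows "integrable (lebesgue_on S) f"
proof (rule Bochner_Integration.integrable_bound)
  interpret finite_measure "lebesgue_on S"
    using assms by (intro finite_measure_lebesgue_on_bounded)
  show "integrable (lebesgue_on S) (\<lambda>x. 1 + (cmod (f x))\<^sup>2)"
    using assms by (auto simp: Lsq_def)
  have "t \<le> 1 + t\<^sup>2" for t :: real
    using zero_le_power2[of "t - 1/2"] by (simp add: power2_eq_square algebra_simps)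
  then show "AE x in lebesgue_on S. cmod (f x) \<le> norm (1 + (cmod (f x))\<^sup>2)"
    by (intro AE_I2) (smt (verit) real_norm_def zero_le_power2)
qed (use assms in \<open>auto simp: Lsq_def\<close>)

lemma Lsq_add:
  assumes "f \<in> Lsq S" "g \<in> Lsq S"
  shows "(\<lambda>x. f x + g x) \<in> Lsq S"
proof -
  have [measurable]: "f \<in> borel_measurable (lebesgue_on S)" "g \<in> borel_measurable (lebesgue_on S)"
    using assms by (auto simp: Lsq_def)
  have "integrable (lebesgue_on S) (\<lambda>x. (cmod (f x + g x))\<^sup>2)"
  proof (rule Bochner_Integration.integrable_bound)
    show "integrable (lebesgue_on S) (\<lambda>x. 2 * (cmod (f x))\<^sup>2 + 2 * (cmod (g x))\<^sup>2)"
      using assms by (auto simp: Lsq_def)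
    have "(cmod (z + w))\<^sup>2 \<le> 2 * (cmod z)\<^sup>2 + 2 * (cmod w)\<^sup>2" for z w
    proof -
      have "(cmod (z + w))\<^sup>2 \<le> (cmod z + cmod w)\<^sup>2"
        by (intro power_mono norm_triangle_ineq norm_ge_zero)
      also have "\<dots> \<le> 2 * (cmod z)\<^sup>2 + 2 * (cmod w)\<^sup>2"
        using zero_le_power2[of "cmod z - cmod w"] by (simp add: power2_eq_square algebra_simps)
      finally show ?thesis .
    qed
    then show "AE x in lebesgue_on S. norm ((cmod (f x + g x))\<^sup>2)
        \<le> norm (2 * (cmod (f x))\<^sup>2 + 2 * (cmod (g x))\<^sup>2)"
      by (intro AE_I2) simp
  qed measurable
  then show ?thesis by (simp add: Lsq_def)
qed

lemma Lsq_scale: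
  assumes "f \<in> Lsq S"
  shows "(\<lambda>x. r *\<^sub>R f x) \<in> Lsq S"
  using assms by (auto simp: Lsq_def power_mult_distrib)

lemma Lsq_cong:
  assumes "\<And>x. x \<in> S \<Longrightarrow> f x = g x"
  shows "f \<in> Lsq S \<longleftrightarrow> g \<in> Lsq S"
proof -
  have "f \<in> borel_measurable (lebesgue_on S) \<longleftrightarrow> g \<in> borel_measurable (lebesgue_on S)"
    by (rule measurable_cong) (simp add: assms)
  moreover have "integrable (lebesgue_on S) (\<lambda>x. (cmod (f x))\<^sup>2)
      \<longleftrightarrow> integrable (lebesgue_on S) (\<lambda>x. (cmod (g x))\<^sup>2)"
    by (rule Bochner_Integration.integrable_cong) (auto simp: assms)
  ultimately show ?thesis by (simp add: Lsq_def)
qed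

lemma Lsq_bounded:
  assumes "bounded S" "S \<in> sets lebesgue" "f \<in> borel_measurable (lebesgue_on S)"
    and "\<And>x. x \<in> S \<Longrightarrow> cmod (f x) \<le> B"
  shows "f \<in> Lsq S"
proof -
  interpret finite_measure "lebesgue_on S"
    using assms by (intro finite_measure_lebesgue_on_bounded)
  have "integrable (lebesgue_on S) (\<lambda>x. (cmod (f x))\<^sup>2)"
    using assms(3,4) by (intro integrable_const_bound[where B="B\<^sup>2"] AE_I2) (auto intro: power_mono)
  then show ?thesis using assms by (simp add: Lsq_def)
qed

lemma Lsq_continuous_on_Icc:
  assumes "continuous_on {c..d} f"
  shows "f \<in> Lsq {c<..<d}"
proof -
  obtain B where "\<forall>x\<in>{c..d}. cmod (f x) \<le> B"
    using compact_imp_bounded[OF compact_continuous_image[OF assms compact_Icc]]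
    by (auto simp: bounded_iff)
  moreover have "f \<in> borel_measurable (lebesgue_on {c<..<d})"
    by (intro continuous_imp_measurable_on_sets_lebesgue continuous_on_subset[OF assms]) auto
  ultimately show ?thesis by (intro Lsq_bounded[where B=B]) auto
qed

lemma test_functions_deriv:
  assumes "\<phi> \<in> test_functions S"
  shows "(\<phi> has_vector_derivative vector_derivative \<phi> (at x)) (at x)"
    and "continuous_on UNIV \<phi>" and "continuous_on UNIV (\<lambda>x. vector_derivative \<phi> (at x))"
  using assms
  by (auto simp: test_functions_def C1_differentiable_on_eq vector_derivative_works[symmetric]
      intro!: continuous_at_imp_continuous_on differentiable_imp_continuous_within)

text \<open>A point off \<open>S\<close> lies in the complement of the support, which is open; hence
  the derivative vanishes there as well, for instance at the end points of an open interval.\<close>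

lemma test_functions_zero:
  assumes "\<phi> \<in> test_functions S" "x \<notin> S"
  shows "\<phi> x = 0" "vector_derivative \<phi> (at x) = 0"
proof -
  let ?K = "closure {x. \<phi> x \<noteq> 0}"
  have x: "x \<in> - ?K" using assms by (auto simp: test_functions_def)
  have z: "\<phi> y = 0" if "y \<in> - ?K" for y using that closure_subset[of "{x. \<phi> x \<noteq> 0}"] by auto
  show "\<phi> x = 0" using x z by blast
  have "((\<lambda>_. 0) has_vector_derivative (0::complex)) (at x)" by simp
  then have "(\<phi> has_vector_derivative 0) (at x)"
    by (rule has_vector_derivative_transform_within_open[OF _ open_Compl[OF closed_closure] x])
      (rule z[symmetric])
  then show "vector_derivative \<phi> (at x) = 0" by (rule vector_derivative_at)
qed

lemma test_functions_bounded:
  assumes "\<phi> \<in> test_functions S" "bounded S"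
  obtains B where "\<And>x. x \<in> S \<Longrightarrow> cmod (\<phi> x) \<le> B"
    and "\<And>x. x \<in> S \<Longrightarrow> cmod (vector_derivative \<phi> (at x)) \<le> B"
proof -
  have K: "compact (closure S)" using assms by (simp add: compact_closure)
  have bdd: "\<exists>B. \<forall>x\<in>closure S. cmod (f x) \<le> B" if "continuous_on UNIV f" for f :: "real \<Rightarrow> complex"
    using compact_imp_bounded[OF compact_continuous_image[OF continuous_on_subset[OF that] K]]
    by (auto simp: bounded_iff)
  obtain B1 where "\<forall>x\<in>closure S. cmod (\<phi> x) \<le> B1"
    using bdd[OF test_functions_deriv(2)[OF assms(1)]] by auto
  moreover obtain B2 where "\<forall>x\<in>closure S. cmod (vector_derivative \<phi> (at x)) \<le> B2"
    using bdd[OF test_functions_deriv(3)[OF assms(1)]] by auto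
  ultimately show ?thesis using closure_subset[of S] by (intro that[of "max B1 B2"]) force+
qed

lemma measurable_continuous_lebesgue_on:
  "continuous_on UNIV f \<Longrightarrow> f \<in> borel_measurable (lebesgue_on S)"
  by (simp add: measurable_restrict_space1 measurable_completion borel_measurable_continuous_onI)

lemma test_functions_measurable:
  assumes "\<phi> \<in> test_functions T"
  shows "\<phi> \<in> borel_measurable (lebesgue_on S)"
    and "(\<lambda>x. vector_derivative \<phi> (at x)) \<in> borel_measurable (lebesgue_on S)"
  using test_functions_deriv(2,3)[OF assms] by (intro measurable_continuous_lebesgue_on; simp)+

lemma integrable_times_test_function:
  assumes "f \<in> Lsq S" "\<phi> \<in> test_functions S" "bounded S" "S \<in> sets lebesgue"
  shows "integrable (lebesgue_on S) (\<lambda>x. f x * \<phi> x)"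
    and "integrable (lebesgue_on S) (\<lambda>x. f x * vector_derivative \<phi> (at x))"
proof -
  obtain B where B: "\<And>x. x \<in> S \<Longrightarrow> cmod (\<phi> x) \<le> B"
      "\<And>x. x \<in> S \<Longrightarrow> cmod (vector_derivative \<phi> (at x)) \<le> B"
    using test_functions_bounded[OF assms(2,3)] by metis
  show "integrable (lebesgue_on S) (\<lambda>x. f x * \<phi> x)"
    and "integrable (lebesgue_on S) (\<lambda>x. f x * vector_derivative \<phi> (at x))"
    using B by (auto intro!: integrable_mult_bounded[where B=B]
        Lsq_integrable[OF assms(1,3,4)] test_functions_measurable[OF assms(2)])
qed

section \<open>Linearity and almost everywhere invariance of weak derivatives\<close>

lemma weak_deriv_add:
  assumes "weak_deriv S f g" "weak_deriv S f' g'" "bounded S" "S \<in> sets lebesgue"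
  shows "weak_deriv S (\<lambda>x. f x + f' x) (\<lambda>x. g x + g' x)"
  using assms
  by (auto simp: weak_deriv_def Lsq_add distrib_right integrable_times_test_function)

lemma weak_deriv_scale:
  assumes "weak_deriv S f g"
  shows "weak_deriv S (\<lambda>x. r *\<^sub>R f x) (\<lambda>x. r *\<^sub>R g x)"
  using assms by (auto simp: weak_deriv_def Lsq_scale)

lemma weak_deriv_cong:
  assumes "weak_deriv S f g" "f' \<in> Lsq S" "g' \<in> Lsq S" "ae_eq S f f'" "ae_eq S g g'"
  shows "weak_deriv S f' g'"
  unfolding weak_deriv_def
proof (intro conjI ballI)
  fix \<phi> assume \<phi>: "\<phi> \<in> test_functions S"
  note [measurable] = test_functions_measurable[OF \<phi>] Lsq_measurable[OF assms(2)]
    Lsq_measurable[OF assms(3)]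
  have [measurable]: "f \<in> borel_measurable (lebesgue_on S)" "g \<in> borel_measurable (lebesgue_on S)"
    using assms(1) by (auto simp: weak_deriv_def Lsq_measurable)
  have "(LINT x|lebesgue_on S. f' x * vector_derivative \<phi> (at x))
      = (LINT x|lebesgue_on S. f x * vector_derivative \<phi> (at x))"
    using assms(4) by (intro integral_cong_AE) (auto simp: ae_eq_def)
  also have "\<dots> = - (LINT x|lebesgue_on S. g x * \<phi> x)"
    using assms(1) \<phi> by (auto simp: weak_deriv_def)
  also have "(LINT x|lebesgue_on S. g x * \<phi> x) = (LINT x|lebesgue_on S. g' x * \<phi> x)"
    using assms(5) by (intro integral_cong_AE) (auto simp: ae_eq_def)
  finally show "(LINT x|lebesgue_on S. f' x * vector_derivative \<phi> (at x))
      = - (LINT x|lebesgue_on S. g' x * \<phi> x)" .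
qed (use assms in auto)

lemma test_functions_mono: "T \<subseteq> S \<Longrightarrow> test_functions T \<subseteq> test_functions S"
  by (auto simp: test_functions_def)

subsection \<open>Lebesgue points and trapezoidal test functions\<close>

lemma integrable_lebesgue_on_Ioo:
  fixes f :: "real \<Rightarrow> complex"
  assumes "integrable (lebesgue_on {c<..<d}) f" "c \<le> s" "t \<le> d"
  shows "f integrable_on {s..t}"
proof -
  have "f integrable_on {c..d}"
    using integrable_on_lebesgue_on[OF assms(1)] by (simp add: integrable_on_Icc_iff_Ioo)
  then show ?thesis using assms(2,3) by (rule_tac integrable_on_subinterval) auto
qed

text \<open>Within the interval, \<open>A\<close> differs from \<open>[s, t]\<close> only by end
  points, a null set. This passes from Lebesgue integrals cut off by an interval or a ray to gauge
  integrals over closed intervals, the form in which primitives are written.\<close>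

lemma LINT_lebesgue_on_Ioo_if:
  fixes f :: "real \<Rightarrow> complex"
  assumes f: "integrable (lebesgue_on {c<..<d}) f" and st: "c \<le> s" "t \<le> d"
    and A: "A \<in> sets lebesgue" "{s<..<t} \<subseteq> A" "A \<inter> {c<..<d} \<subseteq> {s..t}"
  shows "(LINT x|lebesgue_on {c<..<d}. (if x \<in> A then f x else 0)) = integral {s..t} f"
proof -
  have AI: "A \<inter> {c<..<d} \<in> sets (lebesgue_on {c<..<d})"
    using sets.Int[OF A(1), of "{c<..<d}"] by (simp add: sets_restrict_space_iff)
  have "integrable (restrict_space (lebesgue_on {c<..<d}) (A \<inter> {c<..<d})) f"
    using integrable_mult_indicator[OF AI f] AI
    by (subst Bochner_Integration.integrable_restrict_space) (simp_all add: Int_assoc)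
  then have int: "integrable (lebesgue_on (A \<inter> {c<..<d})) f"
    by (subst (asm) restrict_restrict_space) (use A in \<open>auto simp: Int_ac\<close>)
  have "(LINT x|lebesgue_on {c<..<d}. (if x \<in> A then f x else 0))
      = (LINT x|lebesgue_on (A \<inter> {c<..<d}). f x)"
    using Lebesgue_Measure.integral_restrict_Int[of A "{c<..<d}" f] A(1) by simp
  also have "\<dots> = integral (A \<inter> {c<..<d}) f"
    using int A(1) by (intro lebesgue_integral_eq_integral) auto
  also have "\<dots> = integral {s..t} f"
  proof (rule integral_spike_set)
    show "negligible {x \<in> A \<inter> {c<..<d} - {s..t}. f x \<noteq> 0}"
      by (rule negligible_subset[OF negligible_empty]) (use A in auto)
    show "negligible {x \<in> {s..t} - A \<inter> {c<..<d}. f x \<noteq> 0}"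
    proof (rule negligible_subset[of "{s, t}"])
      have "x \<in> A \<inter> {c<..<d}" if "s < x" "x < t" for x using that A(2) st by auto
      then show "{x \<in> {s..t} - A \<inter> {c<..<d}. f x \<noteq> 0} \<subseteq> {s, t}" by force
    qed auto
  qed
  finally show ?thesis .
qed

text \<open>One-sided Lebesgue differentiation. Averages to the right are the ones that occur below,
  because the slopes of the trapezoids extend to the right of \<open>s\<close> and
  \<open>t\<close>.\<close>

lemma AE_lebesgue_point:
  fixes f :: "real \<Rightarrow> complex"
  assumes "integrable (lebesgue_on {c<..<d}) f"
  shows "AE x in lebesgue_on {c<..<d}.
    ((\<lambda>h. integral {x..x + h} f /\<^sub>R h) \<longlongrightarrow> f x) (at_right 0)"
proof -
  \<comment> \<open>Extension by zero gives integrability over every box; for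
    \<open>h < d - x\<close> the interval \<open>[x, x + h]\<close> stays inside, so the averages of
    \<open>?f\<close> and \<open>f\<close> coincide.\<close>
  let ?f = "\<lambda>x. if x \<in> {c<..<d} then f x else 0"
  have "f integrable_on {c<..<d}" using assms by (rule integrable_on_lebesgue_on) auto
  then have "?f integrable_on UNIV" by (simp only: integrable_restrict_UNIV)
  then have "?f integrable_on cbox a b" for a b
    by (rule integrable_on_subcbox) auto
  then obtain N where N: "negligible N"
    "\<And>x e. \<lbrakk>x \<notin> N; 0 < e\<rbrakk> \<Longrightarrow> \<exists>\<delta>>0. \<forall>h. 0 < h \<and> h < \<delta> \<longrightarrow>
       norm (integral (cbox x (x + h *\<^sub>R One)) ?f /\<^sub>R h ^ DIM(real) - ?f x) < e"
    using integrable_ccontinuous_explicit[of ?f] by blast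
  have lim: "((\<lambda>h. integral {x..x + h} f /\<^sub>R h) \<longlongrightarrow> f x) (at_right 0)"
    if x: "x \<in> {c<..<d}" "x \<notin> N" for x
    unfolding tendsto_iff
  proof (intro allI impI)
    fix e :: real assume "0 < e"
    from N(2)[OF x(2) this] obtain \<delta> where \<delta>: "\<delta> > 0" "\<And>h. 0 < h \<Longrightarrow> h < \<delta> \<Longrightarrow>
       norm (integral {x..x + h} ?f /\<^sub>R h - ?f x) < e"
      by auto
    have "dist (integral {x..x + h} f /\<^sub>R h) (f x) < e" if "h \<in> {0<..<min \<delta> (d - x)}" for h
    proof -
      have "integral {x..x + h} ?f = integral {x..x + h} f"
        using that x by (intro integral_cong) auto
      then show ?thesis using \<delta>(2)[of h] that x by (auto simp: dist_norm)
    qed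
    moreover have "min \<delta> (d - x) > 0" using \<delta> x by auto
    ultimately show "\<forall>\<^sub>F h in at_right 0. dist (integral {x..x + h} f /\<^sub>R h) (f x) < e"
      unfolding eventually_at_right_field by (meson greaterThanLessThan_iff)
  qed
  have "AE x in lebesgue. x \<notin> N"
    using N(1) by (simp add: negligible_iff_null_sets AE_not_in)
  then show ?thesis
    by (subst AE_lebesgue_on_iff) (auto elim!: eventually_mono intro: lim)
qed

text \<open>A constant primitive has zero averages over \<open>[x, x + h]\<close>, and at a Lebesgue
  point these tend to \<open>g x\<close>.\<close>

lemma AE_zero_if_integral_const:
  fixes g :: "real \<Rightarrow> complex"
  assumes g: "integrable (lebesgue_on {c<..<d}) g"
    and K: "\<And>x. x \<in> {c<..<d} \<Longrightarrow> integral {c..x} g = K"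
  shows "AE x in lebesgue_on {c<..<d}. g x = 0"
  using AE_lebesgue_point[OF g]
proof (rule lebesgue_on_mono)
  fix x assume lim: "((\<lambda>h. integral {x..x + h} g /\<^sub>R h) \<longlongrightarrow> g x) (at_right 0)" and x: "x \<in> {c<..<d}"
  have "integral {x..x + h} g = 0" if "h > 0" "h < d - x" for h
  proof -
    have "integral {c..x} g + integral {x..x + h} g = integral {c..x + h} g"
      using that x by (intro Henstock_Kurzweil_Integration.integral_combine integrable_lebesgue_on_Ioo[OF g]) auto
    then show ?thesis using K[of x] K[of "x + h"] that x by auto
  qed
  then have "\<forall>\<^sub>F h in at_right 0. integral {x..x + h} g /\<^sub>R h = 0"
    using x unfolding eventually_at_right_field by (intro exI[of _ "d - x"]) auto
  then have "((\<lambda>h. integral {x..x + h} g /\<^sub>R h) \<longlongrightarrow> 0) (at_right 0)"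
    by (rule tendsto_eventually)
  then show "g x = 0" using lim tendsto_unique trivial_limit_at_right_real by blast
qed

text \<open>\<open>smooth_relu e\<close> is a \<open>C\<^sup>1\<close> approximation of the positive part, with derivative
  \<open>relu_quot e\<close>; a second difference of it is a trapezoid with rounded corners.\<close>

definition relu_quot :: "real \<Rightarrow> real \<Rightarrow> real" where
  "relu_quot e x = (max 0 x - max 0 (x - e)) / e"

definition smooth_relu :: "real \<Rightarrow> real \<Rightarrow> real" where
  "smooth_relu e x = ((max 0 x)\<^sup>2 - (max 0 (x - e))\<^sup>2) / (2 * e)"

lemma has_derivative_relu_sq:
  "((\<lambda>x::real. (max 0 x)\<^sup>2) has_real_derivative 2 * max 0 x) (at x)"
proof (cases x "0::real" rule: linorder_cases)
  case less
  have "((\<lambda>_. 0) has_real_derivative 0) (at x)" by simp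
  then have "((\<lambda>x::real. (max 0 x)\<^sup>2) has_real_derivative 0) (at x)"
    by (rule has_field_derivative_transform_within_open[where S="{..<0}"]) (use less in auto)
  then show ?thesis using less by simp
next
  case greater
  have "((\<lambda>x. x\<^sup>2) has_real_derivative 2 * x) (at x)" by (auto intro!: derivative_eq_intros)
  then have "((\<lambda>x::real. (max 0 x)\<^sup>2) has_real_derivative 2 * x) (at x)"
    by (rule has_field_derivative_transform_within_open[where S="{0<..}"]) (use greater in auto)
  then show ?thesis using greater by simp
next
  case equal
  \<comment> \<open>At the kink, Caratheodory's criterion applies with slope function
    \<open>max 0\<close>, since \<open>(max 0 x)^2 = max 0 x * x\<close>.\<close>
  have "isCont (max (0::real)) 0"
    by (intro continuous_intros)
  then show ?thesis
    unfolding CARAT_DERIV equal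
    by (intro exI[of _ "max 0"]) (auto simp: power2_eq_square max_def)
qed

lemma smooth_relu_deriv:
  assumes "e > 0"
  shows "(smooth_relu e has_real_derivative relu_quot e x) (at x)"
proof -
  have "((\<lambda>x. (max 0 (x - e))\<^sup>2) has_real_derivative 2 * max 0 (x - e) * 1) (at x)"
    by (rule DERIV_chain2[OF has_derivative_relu_sq]) (auto intro!: derivative_eq_intros)
  then have "((\<lambda>x. ((max 0 x)\<^sup>2 - (max 0 (x - e))\<^sup>2) / (2 * e)) has_real_derivative
      (2 * max 0 x - 2 * max 0 (x - e) * 1) / (2 * e)) (at x)"
    by (intro DERIV_cdivide DERIV_diff has_derivative_relu_sq)
  moreover have "(2 * max 0 x - 2 * max 0 (x - e) * 1) / (2 * e) = relu_quot e x"
    using assms by (simp add: relu_quot_def field_simps)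
  ultimately show ?thesis
    by (simp add: smooth_relu_def[abs_def])
qed

lemma relu_quot_bounds: "e > 0 \<Longrightarrow> 0 \<le> relu_quot e x \<and> relu_quot e x \<le> 1"
  by (auto simp: relu_quot_def divide_simps)

lemma relu_quot_continuous: "continuous_on A (relu_quot e)"
  unfolding relu_quot_def[abs_def] divide_inverse by (intro continuous_intros)

text \<open>For \<open>x > 0\<close> the quotient is 1 as soon as \<open>e < x\<close>, and for
  \<open>x \<le> 0\<close> it is always 0. The jump point gets the value 0, which is why intervals
  open on the left appear below.\<close>

lemma relu_quot_tendsto:
  "((\<lambda>e. relu_quot e x) \<longlongrightarrow> of_bool (0 < x)) (at_right 0)"
proof (rule tendsto_eventually)
  show "\<forall>\<^sub>F e in at_right 0. relu_quot e x = of_bool (0 < x)"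
    unfolding eventually_at_right_field
    by (rule exI[of _ "if 0 < x then x else 1"]) (auto simp: relu_quot_def)
qed

lemma smooth_relu_nonpos: "e > 0 \<Longrightarrow> x \<le> 0 \<Longrightarrow> smooth_relu e x = 0"
  by (simp add: smooth_relu_def)

lemma smooth_relu_ge: "e > 0 \<Longrightarrow> e \<le> x \<Longrightarrow> smooth_relu e x = x - e / 2"
  by (simp add: smooth_relu_def field_simps power2_eq_square)

lemma smooth_relu_tendsto: "((\<lambda>e. smooth_relu e x) \<longlongrightarrow> max 0 x) (at_right 0)"
proof (cases "x > 0")
  case True
  have "\<forall>\<^sub>F e in at_right 0. x - e / 2 = smooth_relu e x"
    unfolding eventually_at_right_field
    by (rule exI[of _ x]) (use True in \<open>auto simp: smooth_relu_ge\<close>)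
  moreover have "((\<lambda>e. x - e / 2) \<longlongrightarrow> x - 0 / 2) (at_right 0)"
    by (intro tendsto_intros) simp
  ultimately show ?thesis using True by (auto intro: Lim_transform_eventually)
next
  case False
  then show ?thesis
    by (intro tendsto_eventually) (auto simp: eventually_at_right_field smooth_relu_nonpos
        intro: exI[of _ 1])
qed

text \<open>A bound independent of \<open>e\<close>, as dominated convergence requires.\<close>

lemma smooth_relu_bound: "e > 0 \<Longrightarrow> \<bar>smooth_relu e x\<bar> \<le> \<bar>x\<bar>"
proof -
  assume e: "e > 0"
  consider "x \<le> 0" | "e \<le> x" | "0 < x" "x < e" by linarith
  then show ?thesis
  proof cases
    case 3
    then have "smooth_relu e x = x * (x / (2 * e))" by (simp add: smooth_relu_def power2_eq_square)
    moreover have "x * (x / (2 * e)) \<le> x * 1" using 3 e by (intro mult_left_mono) auto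
    moreover have "0 \<le> x * (x / (2 * e))" using 3 e by simp
    ultimately show ?thesis using 3 by linarith
  qed (use e in \<open>auto simp: smooth_relu_nonpos smooth_relu_ge\<close>)
qed


text \<open>As \<open>e\<close> tends to 0, this becomes a ramp of slope \<open>1/h\<close> over
  \<open>[s, s + h]\<close> minus the same ramp over \<open>[t, t + h]\<close>; \<open>e\<close>
  only rounds the corners. No order of \<open>s\<close> and \<open>t\<close> is imposed: for
  \<open>t < s\<close> the trapezoid is negative.\<close>

definition bump :: "real \<Rightarrow> real \<Rightarrow> real \<Rightarrow> real \<Rightarrow> real \<Rightarrow> complex" where
  "bump e h s t x = of_real ((smooth_relu e (x - s) - smooth_relu e (x - (s + h))
     - smooth_relu e (x - t) + smooth_relu e (x - (t + h))) / h)"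

definition bump_deriv :: "real \<Rightarrow> real \<Rightarrow> real \<Rightarrow> real \<Rightarrow> real \<Rightarrow> complex" where
  "bump_deriv e h s t x = of_real ((relu_quot e (x - s) - relu_quot e (x - (s + h))
     - relu_quot e (x - t) + relu_quot e (x - (t + h))) / h)"

lemma bump_has_derivative:
  assumes "e > 0"
  shows "(bump e h s t has_vector_derivative bump_deriv e h s t x) (at x)"
proof -
  have d: "((\<lambda>x. smooth_relu e (x - r)) has_real_derivative relu_quot e (x - r)) (at x)" for r
  proof -
    have "((\<lambda>x. x - r) has_real_derivative 1) (at x)" by (auto intro!: derivative_eq_intros)
    from DERIV_chain2[OF smooth_relu_deriv[OF assms] this] show ?thesis by simp
  qed
  show ?thesis
    unfolding bump_def[abs_def] bump_deriv_def
    by (intro has_vector_derivative_of_real DERIV_cdivide DERIV_add DERIV_diff d)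
qed

lemma bump_test_function:
  assumes e: "e > 0" and h: "h > 0" and "c < s" "c < t" "s + h + e < d" "t + h + e < d"
  shows "bump e h s t \<in> test_functions {c<..<d}"
proof -
  let ?K = "{min s t..max s t + h + e}"
  \<comment> \<open>To the right of \<open>max s t + h + e\<close> all four terms are affine, and
    they cancel.\<close>
  have "bump e h s t x = 0" if "x \<notin> ?K" for x
    using that e h by (auto simp: bump_def smooth_relu_nonpos smooth_relu_ge not_le)
  then have "{x. bump e h s t x \<noteq> 0} \<subseteq> ?K" by blast
  then have K: "closure {x. bump e h s t x \<noteq> 0} \<subseteq> ?K" by (rule closure_minimal) simp
  moreover have "compact (closure {x. bump e h s t x \<noteq> 0})"
    using bounded_subset[OF bounded_closed_interval K] by (simp add: compact_eq_bounded_closed)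
  moreover have "continuous_on UNIV (bump_deriv e h s t)"
    unfolding bump_deriv_def[abs_def] divide_inverse
    by (intro continuous_intros continuous_on_compose2[OF relu_quot_continuous[of UNIV]]) auto
  moreover have "?K \<subseteq> {c<..<d}" using assms by auto
  ultimately show ?thesis
    using bump_has_derivative[OF e]
    by (auto simp: test_functions_def C1_differentiable_on_def intro!: exI[of _ "bump_deriv e h s t"])
qed

subsection \<open>Weakly differentiable functions are primitives\<close>

text \<open>Dominated convergence for a real parameter, by testing along arbitrary sequences
  decreasing into 0 from the right.\<close>

lemma LINT_mult_tendsto_at_right:
  fixes f :: "real \<Rightarrow> complex" and \<psi> :: "real \<Rightarrow> real \<Rightarrow> complex"
  assumes f: "integrable M f" and r: "r > 0"
    and \<psi>: "\<And>e. 0 < e \<Longrightarrow> e < r \<Longrightarrow> \<psi> e \<in> borel_measurable M"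
    and B: "\<And>e x. 0 < e \<Longrightarrow> e < r \<Longrightarrow> x \<in> space M \<Longrightarrow> cmod (\<psi> e x) \<le> B"
    and lim: "\<And>x. x \<in> space M \<Longrightarrow> ((\<lambda>e. \<psi> e x) \<longlongrightarrow> \<psi>' x) (at_right 0)"
  shows "((\<lambda>e. LINT x|M. f x * \<psi> e x) \<longlongrightarrow> (LINT x|M. f x * \<psi>' x)) (at_right 0)"
proof (rule tendsto_at_right_sequentially[OF r])
  fix S :: "nat \<Rightarrow> real"
  assume S: "\<And>n. 0 < S n" "\<And>n. S n < r" "S \<longlonglongrightarrow> 0"
  have "filterlim S (at_right 0) sequentially"
    using S(1,3) by (simp add: filterlim_at less_imp_neq[symmetric])
  then have lim': "(\<lambda>n. \<psi> (S n) x) \<longlonglongrightarrow> \<psi>' x" if "x \<in> space M" for x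
    using lim[OF that] by (rule filterlim_compose[rotated])
  have [measurable]: "f \<in> borel_measurable M" "\<And>n. \<psi> (S n) \<in> borel_measurable M"
    using f S \<psi> by auto
  have [measurable]: "\<psi>' \<in> borel_measurable M"
    by (rule borel_measurable_LIMSEQ_metric[where f="\<lambda>n. \<psi> (S n)"]) (use lim' in auto)
  show "(\<lambda>n. LINT x|M. f x * \<psi> (S n) x) \<longlonglongrightarrow> (LINT x|M. f x * \<psi>' x)"
  proof (rule integral_dominated_convergence[where w="\<lambda>x. cmod (f x) * B"])
    show "AE x in M. (\<lambda>n. f x * \<psi> (S n) x) \<longlonglongrightarrow> f x * \<psi>' x"
      by (intro AE_I2 tendsto_intros lim')
    show "AE x in M. cmod (f x * \<psi> (S n) x) \<le> cmod (f x) * B" for n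
      using B[OF S(1) S(2)] by (intro AE_I2) (simp add: norm_mult mult_left_mono)
  qed (use f in auto)
qed

lemma continuous_on_bump: "e > 0 \<Longrightarrow> continuous_on A (bump e h s t)"
  using bump_has_derivative
  by (intro continuous_at_imp_continuous_on ballI has_vector_derivative_continuous)

lemma continuous_on_relu_quot_shift: "continuous_on A (\<lambda>x. relu_quot e (x - s))"
  by (intro continuous_on_compose2[OF relu_quot_continuous[of UNIV]] continuous_intros) auto

text \<open>First limit: test against \<open>bump e h s t\<close> and let \<open>e\<close> tend to 0
  with \<open>h\<close> fixed. The derivative of the bump tends to \<open>1/h\<close> times the
  difference of the indicators of \<open>(s, s + h]\<close> and \<open>(t, t + h]\<close>, which
  produces averages of \<open>f\<close>; the bump itself tends to a difference of ramps.\<close>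

lemma weak_deriv_difference_quotient:
  assumes w: "weak_deriv {c<..<d} f g"
    and s: "c < s" "s + h < d" and t: "c < t" "t + h < d" and h: "h > 0"
  shows "integral {s..s + h} f /\<^sub>R h - integral {t..t + h} f /\<^sub>R h
    = - (LINT x|lebesgue_on {c<..<d}. g x * of_real (relu_quot h (x - s) - relu_quot h (x - t)))"
proof -
  let ?M = "lebesgue_on {c<..<d}"
  \<comment> \<open>The support reaches at most to \<open>max s t + h + e\<close>, so it stays
    inside the interval for \<open>e < r\<close>.\<close>
  define r where "r = min (d - (s + h)) (d - (t + h))"
  have r: "r > 0" using s t by (auto simp: r_def)
  have f: "integrable ?M f" and g: "integrable ?M g"
    using w by (auto simp: weak_deriv_def intro!: Lsq_integrable)
  let ?\<chi> = "\<lambda>x. of_real ((of_bool (0 < x - s) - of_bool (0 < x - (s + h))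
     - of_bool (0 < x - t) + of_bool (0 < x - (t + h))) / h) :: complex"
  let ?\<beta> = "\<lambda>x. of_real ((max 0 (x - s) - max 0 (x - (s + h))
     - max 0 (x - t) + max 0 (x - (t + h))) / h) :: complex"
  have L: "((\<lambda>e. LINT x|?M. f x * bump_deriv e h s t x) \<longlongrightarrow> (LINT x|?M. f x * ?\<chi> x)) (at_right 0)"
  proof (rule LINT_mult_tendsto_at_right[OF f r])
    show "bump_deriv e h s t \<in> borel_measurable ?M" for e
      unfolding bump_deriv_def[abs_def] divide_inverse
      by (intro measurable_continuous_lebesgue_on continuous_intros continuous_on_relu_quot_shift)
    show "cmod (bump_deriv e h s t x) \<le> 4 / h" if "e > 0" for e x
    proof -
      note b = relu_quot_bounds[OF that]
      show ?thesis
        using b[of "x - s"] b[of "x - (s + h)"] b[of "x - t"] b[of "x - (t + h)"] h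
        unfolding bump_deriv_def norm_of_real
        by (simp add: abs_divide divide_right_mono abs_le_iff)
    qed
    show "((\<lambda>e. bump_deriv e h s t x) \<longlongrightarrow> ?\<chi> x) (at_right 0)" for x
      unfolding bump_deriv_def by (intro tendsto_intros relu_quot_tendsto) (use h in auto)
  qed
  have R: "((\<lambda>e. LINT x|?M. g x * bump e h s t x) \<longlongrightarrow> (LINT x|?M. g x * ?\<beta> x)) (at_right 0)"
  proof (rule LINT_mult_tendsto_at_right[OF g r])
    show "bump e h s t \<in> borel_measurable ?M" if "e > 0" for e
      using that by (intro measurable_continuous_lebesgue_on continuous_on_bump)
    \<comment> \<open>Each of the four terms is at most \<open>|x - y|\<close> with \<open>x\<close>
      and \<open>y\<close> both in \<open>(c, d)\<close>, hence at most
      \<open>d - c\<close>.\<close>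
    show "cmod (bump e h s t x) \<le> 4 * (d - c) / h" if "e > 0" "x \<in> space ?M" for e x
    proof -
      have b: "\<bar>smooth_relu e (x - y)\<bar> \<le> d - c" if "c < y" "y < d" for y
        using smooth_relu_bound[OF \<open>e > 0\<close>, of "x - y"] \<open>x \<in> space ?M\<close> that by auto
      show ?thesis
        using b[of s] b[of "s + h"] b[of t] b[of "t + h"] h s t
        unfolding bump_def norm_of_real
        by (simp add: abs_divide divide_right_mono abs_le_iff)
    qed
    show "((\<lambda>e. bump e h s t x) \<longlongrightarrow> ?\<beta> x) (at_right 0)" for x
      unfolding bump_def by (intro tendsto_intros smooth_relu_tendsto) (use h in auto)
  qed
  have eq: "(LINT x|?M. f x * bump_deriv e h s t x) = - (LINT x|?M. g x * bump e h s t x)"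
    if "e \<in> {0<..<r}" for e
  proof -
    have "vector_derivative (bump e h s t) (at x) = bump_deriv e h s t x" for x
      using that by (intro vector_derivative_at bump_has_derivative) auto
    moreover have "bump e h s t \<in> test_functions {c<..<d}"
      using that s t h by (intro bump_test_function) (auto simp: r_def)
    ultimately show ?thesis using w by (force simp: weak_deriv_def)
  qed
  have "((\<lambda>e. LINT x|?M. f x * bump_deriv e h s t x) \<longlongrightarrow> - (LINT x|?M. g x * ?\<beta> x)) (at_right 0)"
    by (rule Lim_transform_eventually[OF tendsto_minus[OF R]])
      (use r eq in \<open>auto simp: eventually_at_right_field intro!: exI[of _ r]\<close>)
  then have lim: "(LINT x|?M. f x * ?\<chi> x) = - (LINT x|?M. g x * ?\<beta> x)"
    using L by (intro tendsto_unique[OF trivial_limit_at_right_real])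
  have "(max 0 (x - s) - max 0 (x - (s + h)) - max 0 (x - t) + max 0 (x - (t + h))) / h
      = relu_quot h (x - s) - relu_quot h (x - t)" for x
    by (simp add: relu_quot_def diff_divide_distrib add_divide_distrib algebra_simps)
  moreover have "(LINT x|?M. f x * ?\<chi> x) = integral {s..s + h} f /\<^sub>R h - integral {t..t + h} f /\<^sub>R h"
  proof -
    have I: "integrable ?M (\<lambda>x. if x \<in> {y<..y + h} then f x else 0)" for y
      using integrable_mult_indicator[OF _ f, of "{y<..y + h} \<inter> {c<..<d}"]
      by (rule Bochner_Integration.integrable_cong[THEN iffD1, rotated 2])
        (auto simp: sets_restrict_space_iff indicator_def)
    have E: "(LINT x|?M. (if x \<in> {y<..y + h} then f x else 0)) = integral {y..y + h} f"
      if "c < y" "y + h < d" for y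
      using that by (intro LINT_lebesgue_on_Ioo_if[OF f]) auto
    have "(LINT x|?M. f x * ?\<chi> x) = (LINT x|?M. ((if x \<in> {s<..s + h} then f x else 0)
         - (if x \<in> {t<..t + h} then f x else 0)) /\<^sub>R h)"
      using h by (intro Bochner_Integration.integral_cong) (auto simp: scaleR_conv_of_real field_simps)
    also have "\<dots> = (integral {s..s + h} f - integral {t..t + h} f) /\<^sub>R h"
      using s t by (simp add: I E del: greaterThanAtMost_iff)
    finally show ?thesis by (simp add: scaleR_diff_right)
  qed
  ultimately show ?thesis using lim by presburger
qed

text \<open>Second limit: let \<open>h\<close> tend to 0. Averages tend to values at the Lebesgue
  points, and ramps to indicators of the rays to the right of \<open>s\<close> and \<open>t\<close>.
  The minus sign is absorbed by passing from integrals up to \<open>d\<close> to integrals from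
  \<open>c\<close>.\<close>

lemma weak_deriv_difference:
  assumes w: "weak_deriv {c<..<d} f g"
    and s: "s \<in> {c<..<d}" "((\<lambda>h. integral {s..s + h} f /\<^sub>R h) \<longlongrightarrow> f s) (at_right 0)"
    and t: "t \<in> {c<..<d}" "((\<lambda>h. integral {t..t + h} f /\<^sub>R h) \<longlongrightarrow> f t) (at_right 0)"
  shows "f s - f t = integral {c..s} g - integral {c..t} g"
proof -
  let ?M = "lebesgue_on {c<..<d}"
  define r where "r = min (d - s) (d - t)"
  have r: "r > 0" using s t by (auto simp: r_def)
  have g: "integrable ?M g"
    using w by (auto simp: weak_deriv_def intro!: Lsq_integrable)
  let ?\<chi> = "\<lambda>x. of_real (of_bool (0 < x - s) - of_bool (0 < x - t)) :: complex"
  have "((\<lambda>h. - (LINT x|?M. g x * of_real (relu_quot h (x - s) - relu_quot h (x - t))))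
      \<longlongrightarrow> - (LINT x|?M. g x * ?\<chi> x)) (at_right 0)"
  proof (intro tendsto_minus LINT_mult_tendsto_at_right[OF g r])
    show "(\<lambda>x. complex_of_real (relu_quot h (x - s) - relu_quot h (x - t))) \<in> borel_measurable ?M" for h
      by (intro measurable_continuous_lebesgue_on continuous_intros continuous_on_relu_quot_shift)
    show "cmod (complex_of_real (relu_quot h (x - s) - relu_quot h (x - t))) \<le> 1" if "h > 0" for h x
      using relu_quot_bounds[OF that, of "x - s"] relu_quot_bounds[OF that, of "x - t"]
      unfolding norm_of_real by linarith
  qed (intro tendsto_intros relu_quot_tendsto)
  moreover have "\<forall>\<^sub>F h in at_right 0.
     - (LINT x|?M. g x * of_real (relu_quot h (x - s) - relu_quot h (x - t)))
     = integral {s..s + h} f /\<^sub>R h - integral {t..t + h} f /\<^sub>R h"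
    unfolding eventually_at_right_field
  proof (intro exI[of _ r] conjI r allI impI)
    fix h assume "0 < h" "h < r"
    then show "- (LINT x|?M. g x * of_real (relu_quot h (x - s) - relu_quot h (x - t)))
        = integral {s..s + h} f /\<^sub>R h - integral {t..t + h} f /\<^sub>R h"
      using s t unfolding r_def
      by (intro weak_deriv_difference_quotient[OF w, symmetric]) auto
  qed
  ultimately have "((\<lambda>h. integral {s..s + h} f /\<^sub>R h - integral {t..t + h} f /\<^sub>R h)
      \<longlongrightarrow> - (LINT x|?M. g x * ?\<chi> x)) (at_right 0)"
    by (rule Lim_transform_eventually)
  then have "f s - f t = - (LINT x|?M. g x * ?\<chi> x)"
    using tendsto_diff[OF s(2) t(2)] by (intro tendsto_unique[OF trivial_limit_at_right_real])
  moreover have "(LINT x|?M. g x * ?\<chi> x) = integral {s..d} g - integral {t..d} g"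
  proof -
    have I: "integrable ?M (\<lambda>x. if x \<in> {y<..} then g x else 0)" for y
      using integrable_mult_indicator[OF _ g, of "{y<..} \<inter> {c<..<d}"]
      by (rule Bochner_Integration.integrable_cong[THEN iffD1, rotated 2])
        (auto simp: sets_restrict_space_iff indicator_def)
    have E: "(LINT x|?M. (if x \<in> {y<..} then g x else 0)) = integral {y..d} g"
      if "y \<in> {c<..<d}" for y
      using that by (intro LINT_lebesgue_on_Ioo_if[OF g]) auto
    have "(LINT x|?M. g x * ?\<chi> x) = (LINT x|?M. ((if x \<in> {s<..} then g x else 0)
         - (if x \<in> {t<..} then g x else 0)))"
      by (intro Bochner_Integration.integral_cong) auto
    also have "\<dots> = integral {s..d} g - integral {t..d} g"
      using s t by (simp add: I E del: greaterThan_iff)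
    finally show ?thesis .
  qed
  moreover have "integral {y..d} g = integral {c..d} g - integral {c..y} g" if "y \<in> {c<..<d}" for y
    using that Henstock_Kurzweil_Integration.integral_combine[of c y d g] integrable_lebesgue_on_Ioo[OF g]
    by (simp add: eq_diff_eq add.commute)
  ultimately show ?thesis using s(1) t(1) by simp
qed

text \<open>One Lebesgue point \<open>t\<close> is fixed and the difference formula is applied at
  almost every \<open>x\<close>; the constant is \<open>f t - integral {c..t} g\<close>.\<close>

lemma weak_deriv_imp_primitive:
  assumes w: "weak_deriv {c<..<d} f g" and cd: "c < d"
  obtains C where "ae_eq {c<..<d} f (\<lambda>x. C + integral {c..x} g)"
proof -
  let ?P = "\<lambda>x. ((\<lambda>h. integral {x..x + h} f /\<^sub>R h) \<longlongrightarrow> f x) (at_right 0)"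
  have f: "integrable (lebesgue_on {c<..<d}) f"
    using w by (auto simp: weak_deriv_def intro!: Lsq_integrable)
  note P = AE_lebesgue_point[OF f]
  have "AE x in lebesgue_on {c<..<d}. ?P x \<and> x \<in> {c<..<d}"
    using P AE_space[of "lebesgue_on {c<..<d}"] by eventually_elim auto
  \<comment> \<open>Since \<open>c < d\<close> the measure is nonzero, so a Lebesgue point
    exists.\<close>
  moreover have "ae_filter (lebesgue_on {c<..<d}) \<noteq> bot"
    using cd by (simp add: ae_filter_eq_bot_iff emeasure_restrict_space)
  ultimately obtain t where t: "?P t" "t \<in> {c<..<d}"
    by (metis (no_types, lifting) eventually_happens trivial_limit_def)
  have "ae_eq {c<..<d} f (\<lambda>x. (f t - integral {c..t} g) + integral {c..x} g)"
    unfolding ae_eq_def using P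
  proof (rule lebesgue_on_mono)
    fix x assume "?P x" "x \<in> {c<..<d}"
    then show "f x = (f t - integral {c..t} g) + integral {c..x} g"
      using weak_deriv_difference[OF w _ _ t(2) t(1), of x] by (simp add: algebra_simps)
  qed
  then show ?thesis by (rule that)
qed

subsection \<open>Primitives are weakly differentiable; traces\<close>

lemma integrable_test_function_deriv:
  assumes "\<phi> \<in> test_functions S" "bounded S" "S \<in> sets lebesgue"
  shows "integrable (lebesgue_on S) (\<lambda>x. vector_derivative \<phi> (at x))"
proof -
  interpret finite_measure "lebesgue_on S"
    using assms by (intro finite_measure_lebesgue_on_bounded)
  obtain B where "\<And>x. x \<in> S \<Longrightarrow> cmod (vector_derivative \<phi> (at x)) \<le> B"
    using test_functions_bounded[OF assms(1,2)] by metis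
  then show ?thesis
    using test_functions_measurable(2)[OF assms(1)]
    by (intro integrable_const_bound[where B=B] AE_I2) auto
qed

lemma continuous_on_primitive:
  fixes g :: "real \<Rightarrow> complex"
  assumes "g \<in> Lsq {c<..<d}"
  shows "continuous_on {c..d} (\<lambda>x. C + integral {c..x} g)"
  using assms
  by (intro continuous_intros indefinite_integral_continuous_1 integrable_lebesgue_on_Ioo[of c d]
      Lsq_integrable) auto

text \<open>Fubini for \<open>g y * \<phi>' x\<close> on the triangle \<open>y < x\<close>:
  integrating over \<open>y\<close> first gives the primitive times \<open>\<phi>'\<close>,
  integrating over \<open>x\<close> first gives \<open>g y * (\<phi> d - \<phi> y)\<close>, and
  \<open>\<phi> d = 0\<close>.\<close>

lemma LINT_primitive_times_test_deriv:
  assumes g: "g \<in> Lsq {c<..<d}" and \<phi>: "\<phi> \<in> test_functions {c<..<d}"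
  shows "(LINT x|lebesgue_on {c<..<d}. integral {c..x} g * vector_derivative \<phi> (at x))
    = - (LINT x|lebesgue_on {c<..<d}. g x * \<phi> x)"
proof -
  let ?M = "lebesgue_on {c<..<d}" and ?\<phi>' = "\<lambda>x. vector_derivative \<phi> (at x)"
  interpret finite_measure ?M
    by (intro finite_measure_lebesgue_on_bounded) auto
  interpret pair_sigma_finite ?M ?M by unfold_locales
  have gi: "integrable ?M g" using g by (intro Lsq_integrable) auto
  have \<phi>i: "integrable ?M ?\<phi>'" using \<phi> by (intro integrable_test_function_deriv) auto
  have [measurable]: "g \<in> borel_measurable ?M" "?\<phi>' \<in> borel_measurable ?M"
    using gi \<phi>i by auto
  have [measurable]: "(\<lambda>x. x) \<in> borel_measurable ?M"
    by (intro measurable_continuous_lebesgue_on continuous_intros)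
  have "bounded {c<..<d}" by simp
  then obtain B where B: "\<And>x. x \<in> {c<..<d} \<Longrightarrow> cmod (?\<phi>' x) \<le> B"
    using test_functions_bounded[OF \<phi>] by metis
  define F where "F = (\<lambda>x y. (if y < x then g y * ?\<phi>' x else 0))"
  have F_meas[measurable]: "case_prod F \<in> borel_measurable (?M \<Otimes>\<^sub>M ?M)"
    unfolding F_def by measurable
  have "integrable (?M \<Otimes>\<^sub>M ?M) (case_prod F)"
  \<comment> \<open>The majorant \<open>B * |g y|\<close> does not depend on \<open>x\<close>, so
    the inner integrals are bounded by a constant, which is integrable over the bounded
    interval.\<close>
  proof (rule Fubini_integrable[OF F_meas])
    have Fle: "cmod (F x y) \<le> B * cmod (g y)" if "x \<in> {c<..<d}" for x y
    proof -
      have "0 \<le> B" using B[OF that] norm_ge_zero order_trans by blast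
      then show ?thesis
        using B[OF that] by (auto simp: F_def norm_mult mult.commute[of B] intro: mult_left_mono)
    qed
    have int: "integrable ?M (F x)" if "x \<in> {c<..<d}" for x
    proof (rule Bochner_Integration.integrable_bound)
      show "integrable ?M (\<lambda>y. B * cmod (g y))" using gi by simp
      show "F x \<in> borel_measurable ?M" unfolding F_def by measurable
      show "AE y in ?M. cmod (F x y) \<le> norm (B * cmod (g y))"
        using Fle[OF that] by (intro AE_I2) (auto intro: order_trans[OF _ abs_ge_self])
    qed
    then show "AE x in ?M. integrable ?M (\<lambda>y. case_prod F (x, y))"
      by (intro AE_I2) simp
    show "integrable ?M (\<lambda>x. LINT y|?M. norm (case_prod F (x, y)))"
    proof (rule integrable_const_bound[where B="LINT y|?M. B * cmod (g y)"])
      show "AE x in ?M. norm (LINT y|?M. norm (case_prod F (x, y))) \<le> (LINT y|?M. B * cmod (g y))"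
      proof (rule AE_I2)
        fix x assume x: "x \<in> space ?M"
        have "(LINT y|?M. cmod (F x y)) \<le> (LINT y|?M. B * cmod (g y))"
          using gi int x Fle by (intro integral_mono) auto
        moreover have "0 \<le> (LINT y|?M. cmod (F x y))" by (rule Bochner_Integration.integral_nonneg) simp
        ultimately show "norm (LINT y|?M. norm (case_prod F (x, y))) \<le> (LINT y|?M. B * cmod (g y))"
          by simp
      qed
    qed measurable
  qed
  then have "(LINT y|?M. LINT x|?M. F x y) = (LINT x|?M. LINT y|?M. F x y)"
    by (rule Fubini_integral)
  moreover have "(LINT y|?M. F x y) = integral {c..x} g * ?\<phi>' x" if "x \<in> {c<..<d}" for x
  proof -
    have "(LINT y|?M. F x y) = (LINT y|?M. (if y \<in> {..<x} then g y else 0) * ?\<phi>' x)"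
      by (intro Bochner_Integration.integral_cong) (auto simp: F_def)
    also have "\<dots> = (LINT y|?M. (if y \<in> {..<x} then g y else 0)) * ?\<phi>' x"
      by simp
    also have "(LINT y|?M. (if y \<in> {..<x} then g y else 0)) = integral {c..x} g"
      using that by (intro LINT_lebesgue_on_Ioo_if[OF gi]) auto
    finally show ?thesis .
  qed
  moreover have "(LINT x|?M. F x y) = - (g y * \<phi> y)" if y: "y \<in> {c<..<d}" for y
  proof -
    have "(LINT x|?M. F x y) = (LINT x|?M. g y * (if x \<in> {y<..} then ?\<phi>' x else 0))"
      by (intro Bochner_Integration.integral_cong) (auto simp: F_def)
    also have "\<dots> = g y * (LINT x|?M. (if x \<in> {y<..} then ?\<phi>' x else 0))"
      by simp
    also have "(LINT x|?M. (if x \<in> {y<..} then ?\<phi>' x else 0)) = integral {y..d} ?\<phi>'"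
      using y by (intro LINT_lebesgue_on_Ioo_if[OF \<phi>i]) auto
    also have "(?\<phi>' has_integral (\<phi> d - \<phi> y)) {y..d}"
      using y test_functions_deriv(1)[OF \<phi>]
      by (intro fundamental_theorem_of_calculus) (auto intro: has_vector_derivative_at_within)
    then have "integral {y..d} ?\<phi>' = - \<phi> y"
      using test_functions_zero(1)[OF \<phi>, of d] by (simp add: integral_unique)
    finally show ?thesis by simp
  qed
  ultimately have "(LINT y|?M. - (g y * \<phi> y)) = (LINT x|?M. integral {c..x} g * ?\<phi>' x)"
    by (smt (verit) Bochner_Integration.integral_cong space_lebesgue_on)
  then show ?thesis by simp
qed

text \<open>The constant contributes \<open>C * (\<phi> d - \<phi> c) = 0\<close>; the rest is the
  preceding lemma.\<close>

lemma weak_deriv_primitive: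
  assumes g: "g \<in> Lsq {c<..<d}"
  shows "weak_deriv {c<..<d} (\<lambda>x. C + integral {c..x} g) g"
  unfolding weak_deriv_def
proof (intro conjI ballI g)
  note prim = continuous_on_primitive[OF g]
  show "(\<lambda>x. C + integral {c..x} g) \<in> Lsq {c<..<d}"
    by (intro Lsq_continuous_on_Icc prim)
  fix \<phi> assume \<phi>: "\<phi> \<in> test_functions {c<..<d}"
  let ?M = "lebesgue_on {c<..<d}" and ?\<phi>' = "\<lambda>x. vector_derivative \<phi> (at x)"
  have \<phi>i: "integrable ?M ?\<phi>'" using \<phi> by (intro integrable_test_function_deriv) auto
  have "(LINT x|?M. ?\<phi>' x) = 0"
  proof (cases "c < d")
    case True
    have "(LINT x|?M. ?\<phi>' x) = integral {c..d} ?\<phi>'"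
      using LINT_lebesgue_on_Ioo_if[OF \<phi>i order_refl order_refl, of UNIV]
      by (simp add: greaterThanLessThan_subseteq_atLeastAtMost_iff)
    moreover have "(?\<phi>' has_integral (\<phi> d - \<phi> c)) {c..d}"
      using True test_functions_deriv(1)[OF \<phi>]
      by (intro fundamental_theorem_of_calculus) (auto intro: has_vector_derivative_at_within)
    ultimately show ?thesis
      using test_functions_zero(1)[OF \<phi>, of d] test_functions_zero(1)[OF \<phi>, of c]
      by (simp add: integral_unique)
  qed simp
  moreover have "(LINT x|?M. (C + integral {c..x} g) * ?\<phi>' x)
      = C * (LINT x|?M. ?\<phi>' x) + (LINT x|?M. integral {c..x} g * ?\<phi>' x)"
  proof -
    have "integrable ?M (\<lambda>x. integral {c..x} g * ?\<phi>' x)"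
      using \<phi> prim[of 0] by (intro integrable_times_test_function Lsq_continuous_on_Icc) auto
    then show ?thesis using \<phi>i by (simp add: distrib_right)
  qed
  ultimately show "(LINT x|?M. (C + integral {c..x} g) * ?\<phi>' x) = - (LINT x|?M. g x * \<phi> x)"
    using LINT_primitive_times_test_deriv[OF g \<phi>] by simp
qed

section \<open>Uniqueness of weak derivatives and boundary traces\<close>

lemma ae_eq_sym: "ae_eq S f g \<Longrightarrow> ae_eq S g f"
  by (simp add: ae_eq_def eq_commute)

lemma ae_eq_trans: "ae_eq S f g \<Longrightarrow> ae_eq S g h \<Longrightarrow> ae_eq S f h"
  unfolding ae_eq_def by (auto elim: eventually_elim2)

lemma ae_eqI: "(\<And>x. x \<in> S \<Longrightarrow> f x = g x) \<Longrightarrow> ae_eq S f g"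
  unfolding ae_eq_def by (intro AE_I2) simp

lemma ae_eq_continuous_on_imp_eq:
  assumes "c < d" "continuous_on {c..d} f" "continuous_on {c..d} g" "ae_eq {c<..<d} f g"
    and x: "x \<in> {c..d}"
  shows "f x = g x"
proof -
  let ?C = "{x \<in> {c..d}. f x = g x}"
  have C: "closed ?C"
    using assms(2,3) continuous_closed_preimage_constant[of "{c..d}" "\<lambda>x. f x - g x" 0]
    by (simp add: continuous_on_diff)
  have "AE x \<in> {c<..<d} in lebesgue. x \<in> ?C"
    using assms(4) by (auto simp: ae_eq_def AE_lebesgue_on_iff elim: eventually_mono)
  then have "{c<..<d} \<subseteq> ?C"
    using mem_closed_if_AE_lebesgue_open[OF open_greaterThanLessThan C] by blast
  then have "closure {c<..<d} \<subseteq> ?C" using C by (rule closure_minimal)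
  then show ?thesis using assms(1) x by auto
qed

text \<open>The two primitives are continuous and agree almost everywhere, so they agree on all of
  \<open>[c, d]\<close>; thus \<open>g - g'\<close> has a constant primitive.\<close>

lemma weak_deriv_unique:
  assumes "weak_deriv {c<..<d} f g" "weak_deriv {c<..<d} f' g'" "ae_eq {c<..<d} f f'" "c < d"
  shows "ae_eq {c<..<d} g g'"
proof -
  have L: "g \<in> Lsq {c<..<d}" "g' \<in> Lsq {c<..<d}" using assms by (auto simp: weak_deriv_def)
  then have i: "integrable (lebesgue_on {c<..<d}) g" "integrable (lebesgue_on {c<..<d}) g'"
    by (auto intro: Lsq_integrable)
  obtain C where C: "ae_eq {c<..<d} f (\<lambda>x. C + integral {c..x} g)"
    using weak_deriv_imp_primitive[OF assms(1,4)] .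
  obtain C' where C': "ae_eq {c<..<d} f' (\<lambda>x. C' + integral {c..x} g')"
    using weak_deriv_imp_primitive[OF assms(2,4)] .
  have "ae_eq {c<..<d} (\<lambda>x. C + integral {c..x} g) (\<lambda>x. C' + integral {c..x} g')"
    using C C' assms(3) by (meson ae_eq_sym ae_eq_trans)
  then have eq: "C + integral {c..x} g = C' + integral {c..x} g'" if "x \<in> {c..d}" for x
    using ae_eq_continuous_on_imp_eq[OF assms(4) continuous_on_primitive[OF L(1)]
        continuous_on_primitive[OF L(2)] _ that] by blast
  have "AE x in lebesgue_on {c<..<d}. g x - g' x = 0"
  proof (rule AE_zero_if_integral_const)
    show "integrable (lebesgue_on {c<..<d}) (\<lambda>x. g x - g' x)" using i by simp
    fix x assume x: "x \<in> {c<..<d}"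
    then have "integral {c..x} (\<lambda>x. g x - g' x) = integral {c..x} g - integral {c..x} g'"
      by (intro Henstock_Kurzweil_Integration.integral_diff integrable_lebesgue_on_Ioo[OF i(1)]
          integrable_lebesgue_on_Ioo[OF i(2)]) auto
    moreover have "integral {c..x} g - integral {c..x} g' = C' - C"
      using eq[of x] x by (auto simp: algebra_simps)
    ultimately show "integral {c..x} (\<lambda>x. g x - g' x) = C' - C" by simp
  qed
  then show ?thesis by (simp add: ae_eq_def)
qed

text \<open>This evaluates the choice in \<open>bdry_trace\<close>: every continuous representative
  gives the same values, end points included.\<close>

lemma bdry_trace_eq:
  assumes "c < d" "continuous_on {c..d} h" "ae_eq {c<..<d} h f" "x \<in> {c..d}"
  shows "bdry_trace c d f x = h x"
proof -
  let ?P = "\<lambda>g. continuous_on {c..d} g \<and> ae_eq {c<..<d} g f"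
  have "?P (SOME g. ?P g)" using assms by (intro someI[of ?P h]) auto
  then show ?thesis
    unfolding bdry_trace_def using assms
    by (intro ae_eq_continuous_on_imp_eq[of c d]) (auto intro: ae_eq_trans ae_eq_sym)
qed

lemma bdry_trace_cong:
  assumes "ae_eq {c<..<d} f g"
  shows "bdry_trace c d f = bdry_trace c d g"
proof -
  have "ae_eq {c<..<d} h f \<longleftrightarrow> ae_eq {c<..<d} h g" for h
    using assms by (meson ae_eq_sym ae_eq_trans)
  then show ?thesis by (simp add: bdry_trace_def fun_eq_iff)
qed

text \<open>The continuous representative is the primitive, so the trace satisfies the fundamental
  theorem of calculus up to the boundary.\<close>

lemma weak_deriv_trace:
  assumes "weak_deriv {c<..<d} f g" "c < d"
  shows "continuous_on {c..d} (bdry_trace c d f)" "ae_eq {c<..<d} (bdry_trace c d f) f"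
    and "x \<in> {c..d} \<Longrightarrow> bdry_trace c d f x = bdry_trace c d f c + integral {c..x} g"
proof -
  have g: "g \<in> Lsq {c<..<d}" using assms by (auto simp: weak_deriv_def)
  obtain C where C: "ae_eq {c<..<d} f (\<lambda>x. C + integral {c..x} g)"
    using weak_deriv_imp_primitive[OF assms] .
  have eq: "bdry_trace c d f x = C + integral {c..x} g" if "x \<in> {c..d}" for x
    using that assms(2) C by (intro bdry_trace_eq continuous_on_primitive[OF g]) (auto intro: ae_eq_sym)
  then show "continuous_on {c..d} (bdry_trace c d f)"
    using continuous_on_primitive[OF g, of C] by (metis (no_types, lifting) continuous_on_cong)
  have "ae_eq {c<..<d} (bdry_trace c d f) (\<lambda>x. C + integral {c..x} g)"
    by (rule ae_eqI) (simp add: eq)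
  then show "ae_eq {c<..<d} (bdry_trace c d f) f" using C by (meson ae_eq_sym ae_eq_trans)
  show "x \<in> {c..d} \<Longrightarrow> bdry_trace c d f x = bdry_trace c d f c + integral {c..x} g"
    using eq[of x] eq[of c] assms(2) by simp
qed

lemma bdry_trace_primitive:
  assumes "g \<in> Lsq {c<..<d}" "c < d" "x \<in> {c..d}"
  shows "bdry_trace c d (\<lambda>x. C + integral {c..x} g) x = C + integral {c..x} g"
  using assms by (intro bdry_trace_eq continuous_on_primitive ae_eqI) auto

subsection \<open>Gluing on two intervals\<close>

lemma ae_eq_Un:
  assumes "S \<in> sets lebesgue" "T \<in> sets lebesgue"
  shows "ae_eq (S \<union> T) f g \<longleftrightarrow> ae_eq S f g \<and> ae_eq T f g"
proof -
  have "(AE x in lebesgue_on (S \<union> T). f x = g x)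
      \<longleftrightarrow> (AE x in lebesgue. (x \<in> S \<longrightarrow> f x = g x) \<and> (x \<in> T \<longrightarrow> f x = g x))"
    unfolding AE_lebesgue_on_iff[OF sets.Un[OF assms]] by (intro AE_cong) auto
  then show ?thesis
    by (simp only: ae_eq_def AE_lebesgue_on_iff assms AE_conj_iff)
qed

text \<open>Reformulation on the whole line, where the indicator of a disjoint union is a sum of
  indicators.\<close>

lemma Lsq_indicator:
  assumes "S \<in> sets lebesgue"
  shows "f \<in> Lsq S \<longleftrightarrow> (\<lambda>x. indicator S x *\<^sub>R f x) \<in> borel_measurable lebesgue \<and>
    integrable lebesgue (\<lambda>x. indicator S x *\<^sub>R (cmod (f x))\<^sup>2)"
  using assms by (simp add: Lsq_def borel_measurable_restrict_space_iff
      Bochner_Integration.integrable_restrict_space)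

lemma Lsq_Un:
  assumes S: "S \<in> sets lebesgue" and T: "T \<in> sets lebesgue" and "S \<inter> T = {}"
  shows "f \<in> Lsq (S \<union> T) \<longleftrightarrow> f \<in> Lsq S \<and> f \<in> Lsq T"
proof
  have ind: "indicator (S \<union> T) x *\<^sub>R y = indicator S x *\<^sub>R y + indicator T x *\<^sub>R y"
    for x and y :: "'a::real_normed_vector"
    using assms(3) by (auto simp: indicator_def)
  show "f \<in> Lsq (S \<union> T)" if "f \<in> Lsq S \<and> f \<in> Lsq T"
    using that unfolding Lsq_indicator[OF sets.Un[OF S T]] ind
    by (auto simp: Lsq_indicator[OF S] Lsq_indicator[OF T])
  have sub: "f \<in> Lsq R" if f: "f \<in> Lsq (S \<union> T)" and R: "R \<in> sets lebesgue" "R \<subseteq> S \<union> T" for R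
  proof -
    have eq: "indicator R x *\<^sub>R indicator (S \<union> T) x *\<^sub>R y = indicator R x *\<^sub>R y"
      for x and y :: "'a::real_normed_vector"
      using R(2) by (auto simp: indicator_def)
    have meas: "(\<lambda>x. indicator (S \<union> T) x *\<^sub>R f x) \<in> borel_measurable lebesgue"
      and int: "integrable lebesgue (\<lambda>x. indicator (S \<union> T) x *\<^sub>R (cmod (f x))\<^sup>2)"
      using f unfolding Lsq_indicator[OF sets.Un[OF S T]] by auto
    have "(\<lambda>x. indicator R x *\<^sub>R indicator (S \<union> T) x *\<^sub>R f x) \<in> borel_measurable lebesgue"
      by (intro borel_measurable_scaleR borel_measurable_indicator meas R)
    moreover have "integrable lebesgue (\<lambda>x. indicator R x *\<^sub>R indicator (S \<union> T) x *\<^sub>R (cmod (f x))\<^sup>2)"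
      by (rule integrable_mult_indicator[OF R(1) int])
    ultimately show ?thesis unfolding Lsq_indicator[OF R(1)] eq by blast
  qed
  show "f \<in> Lsq S \<and> f \<in> Lsq T" if "f \<in> Lsq (S \<union> T)"
    using sub[OF that S] sub[OF that T] by auto
qed

lemma LINT_lebesgue_on_Un:
  fixes f :: "real \<Rightarrow> complex"
  assumes S: "S \<in> sets lebesgue" and T: "T \<in> sets lebesgue" and "S \<inter> T = {}"
    and "integrable (lebesgue_on S) f" "integrable (lebesgue_on T) f"
  shows "(LINT x|lebesgue_on (S \<union> T). f x) = (LINT x|lebesgue_on S. f x) + (LINT x|lebesgue_on T. f x)"
proof -
  have ind: "indicator (S \<union> T) x *\<^sub>R y = indicator S x *\<^sub>R y + indicator T x *\<^sub>R y" for x and y :: complex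
    using assms(3) by (auto simp: indicator_def)
  have i: "integrable lebesgue (\<lambda>x. indicator S x *\<^sub>R f x)" "integrable lebesgue (\<lambda>x. indicator T x *\<^sub>R f x)"
    using assms by (auto simp: Bochner_Integration.integrable_restrict_space)
  have "S \<union> T \<in> sets lebesgue" using S T by (rule sets.Un)
  then show ?thesis
    using S T i by (simp add: Bochner_Integration.integral_restrict_space ind)
qed

text \<open>A test function on \<open>T\<close> is one on \<open>S\<close>, and it vanishes off
  \<open>T\<close> together with its derivative.\<close>

lemma weak_deriv_subset:
  assumes w: "weak_deriv S f g" and "T \<subseteq> S" "S \<in> sets lebesgue" "T \<in> sets lebesgue"
    and L: "f \<in> Lsq T" "g \<in> Lsq T"
  shows "weak_deriv T f g"
  unfolding weak_deriv_def
proof (intro conjI ballI L)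
  fix \<phi> assume \<phi>: "\<phi> \<in> test_functions T"
  have restr: "(LINT x|lebesgue_on S. h x * \<psi> x) = (LINT x|lebesgue_on T. h x * \<psi> x)"
    if "\<And>x. x \<notin> T \<Longrightarrow> \<psi> x = 0" for h \<psi> :: "real \<Rightarrow> complex"
  proof -
    have "(LINT x|lebesgue_on S. h x * \<psi> x) = (LINT x|lebesgue_on S. (if x \<in> T then h x * \<psi> x else 0))"
      using that by (intro Bochner_Integration.integral_cong) auto
    then show ?thesis using Lebesgue_Measure.integral_restrict[of T S] assms by simp
  qed
  show "(LINT x|lebesgue_on T. f x * vector_derivative \<phi> (at x)) = - (LINT x|lebesgue_on T. g x * \<phi> x)"
    using w \<phi> test_functions_mono[OF assms(2)] test_functions_zero[OF \<phi>]
    by (auto simp: weak_deriv_def restr[symmetric])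
qed

text \<open>The support \<open>K\<close> splits: \<open>K - T\<close> is compact and lies in
  \<open>S\<close>, so cutting off at the edge of \<open>S\<close> takes place where the function is
  already zero.\<close>

lemma test_functions_restrict:
  assumes \<phi>: "\<phi> \<in> test_functions (S \<union> T)" and S: "open S" and T: "open T" and disj: "S \<inter> T = {}"
  defines "\<phi>S \<equiv> \<lambda>x. if x \<in> S then \<phi> x else 0"
  shows "\<phi>S \<in> test_functions S"
    and "x \<in> S \<Longrightarrow> vector_derivative \<phi>S (at x) = vector_derivative \<phi> (at x)"
proof -
  define K where "K = closure {x. \<phi> x \<noteq> 0}"
  define D where "D = (\<lambda>x. if x \<in> S then vector_derivative \<phi> (at x) else 0)"
  have K: "compact K" "K \<subseteq> S \<union> T" using \<phi> by (auto simp: test_functions_def K_def)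
  have zero: "\<phi> x = 0" if "x \<notin> K" for x
    using that closure_subset[of "{x. \<phi> x \<noteq> 0}"] by (auto simp: K_def)
  have KT: "compact (K - T)" using K T by (intro compact_diff)
  have O: "open (- (K - T))" using KT compact_imp_closed by blast
  have out: "\<phi>S x = 0" if "x \<in> - (K - T)" for x
    using that zero[of x] disj by (auto simp: \<phi>S_def)
  have dS: "(\<phi>S has_vector_derivative vector_derivative \<phi> (at x)) (at x)" if "x \<in> S" for x
    by (rule has_vector_derivative_transform_within_open[OF test_functions_deriv(1)[OF \<phi>] S that])
      (simp add: \<phi>S_def)
  then show "x \<in> S \<Longrightarrow> vector_derivative \<phi>S (at x) = vector_derivative \<phi> (at x)"
    by (intro vector_derivative_at)
  have dO: "(\<phi>S has_vector_derivative 0) (at x)" if "x \<in> - (K - T)" for x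
    by (rule has_vector_derivative_transform_within_open[OF has_vector_derivative_const O that])
      (simp add: out)
  have DO: "D x = 0" if "x \<in> - (K - T)" for x
    using dS dO[OF that] by (auto simp: D_def dest: vector_derivative_unique_at)
  \<comment> \<open>Two open sets cover the line: on \<open>S\<close> the restriction is
    \<open>\<phi>\<close>, on the complement of \<open>K - T\<close> it is zero. Differentiability
    and continuity of \<open>D\<close> are therefore local checks.\<close>
  have cover: "S \<union> - (K - T) = UNIV" using K(2) by auto
  have "(\<phi>S has_vector_derivative D x) (at x)" for x
    using dS[of x] dO[of x] DO[of x] cover by (cases "x \<in> S") (auto simp: D_def)
  moreover have "continuous_on (S \<union> - (K - T)) D"
  proof (rule continuous_on_open_Un[OF S O])
    show "continuous_on S D"
      using continuous_on_subset[OF test_functions_deriv(3)[OF \<phi>], of S]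
      by (simp add: D_def cong: continuous_on_cong)
    show "continuous_on (- (K - T)) D"
      using continuous_on_const[of "- (K - T)" 0] by (metis (no_types, lifting) DO continuous_on_cong)
  qed
  moreover have sub: "closure {x. \<phi>S x \<noteq> 0} \<subseteq> K - T"
    using out KT by (intro closure_minimal compact_imp_closed) auto
  moreover have "compact (closure {x. \<phi>S x \<noteq> 0})"
    using bounded_subset[OF compact_imp_bounded[OF KT] sub] by (simp add: compact_eq_bounded_closed)
  ultimately show "\<phi>S \<in> test_functions S"
    using K(2) cover by (auto simp: test_functions_def C1_differentiable_on_def)
qed

text \<open>A test function on the union is split into its parts on \<open>S\<close> and
  \<open>T\<close>, each a test function there; \<open>part\<close> serves both sides with the roles
  exchanged.\<close>

lemma weak_deriv_Un:
  assumes S: "open S" "bounded S" and T: "open T" "bounded T" and disj: "S \<inter> T = {}"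
    and w: "weak_deriv S f g" "weak_deriv T f g"
  shows "weak_deriv (S \<union> T) f g"
proof -
  have ST: "S \<in> sets lebesgue" "T \<in> sets lebesgue" using S T by auto
  show ?thesis
    unfolding weak_deriv_def
  proof (intro conjI ballI)
    show "f \<in> Lsq (S \<union> T)" "g \<in> Lsq (S \<union> T)"
      using w Lsq_Un[OF ST disj] by (auto simp: weak_deriv_def)
    fix \<phi> assume \<phi>: "\<phi> \<in> test_functions (S \<union> T)"
    have part: "integrable (lebesgue_on R) (\<lambda>x. f x * vector_derivative \<phi> (at x))
        \<and> integrable (lebesgue_on R) (\<lambda>x. g x * \<phi> x)
        \<and> (LINT x|lebesgue_on R. f x * vector_derivative \<phi> (at x)) = - (LINT x|lebesgue_on R. g x * \<phi> x)"
      if R: "open R" "bounded R" and Q: "open Q" "R \<inter> Q = {}" "\<phi> \<in> test_functions (R \<union> Q)"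
        and w: "weak_deriv R f g" for R Q
    proof -
      let ?\<phi> = "\<lambda>x. if x \<in> R then \<phi> x else 0"
      have t: "?\<phi> \<in> test_functions R"
        and d: "\<And>x. x \<in> R \<Longrightarrow> vector_derivative ?\<phi> (at x) = vector_derivative \<phi> (at x)"
        using test_functions_restrict[OF Q(3) R(1) Q(1,2)] by auto
      have fg: "f \<in> Lsq R" "g \<in> Lsq R" using w by (auto simp: weak_deriv_def)
      have R': "R \<in> sets lebesgue" using R by auto
      have "integrable (lebesgue_on R) (\<lambda>x. f x * vector_derivative ?\<phi> (at x))"
        using integrable_times_test_function(2)[OF fg(1) t R(2) R'] .
      moreover have "integrable (lebesgue_on R) (\<lambda>x. g x * ?\<phi> x)"
        using integrable_times_test_function(1)[OF fg(2) t R(2) R'] .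
      moreover have "(LINT x|lebesgue_on R. f x * vector_derivative ?\<phi> (at x))
          = - (LINT x|lebesgue_on R. g x * ?\<phi> x)"
        using w t by (auto simp: weak_deriv_def)
      moreover have
        "integrable (lebesgue_on R) (\<lambda>x. f x * vector_derivative ?\<phi> (at x))
          \<longleftrightarrow> integrable (lebesgue_on R) (\<lambda>x. f x * vector_derivative \<phi> (at x))"
        "integrable (lebesgue_on R) (\<lambda>x. g x * ?\<phi> x) \<longleftrightarrow> integrable (lebesgue_on R) (\<lambda>x. g x * \<phi> x)"
        by (intro Bochner_Integration.integrable_cong; simp add: d)+
      moreover have
        "(LINT x|lebesgue_on R. f x * vector_derivative ?\<phi> (at x))
          = (LINT x|lebesgue_on R. f x * vector_derivative \<phi> (at x))"
        "(LINT x|lebesgue_on R. g x * ?\<phi> x) = (LINT x|lebesgue_on R. g x * \<phi> x)"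
        by (intro Bochner_Integration.integral_cong; simp add: d)+
      ultimately show ?thesis by simp
    qed
    have "T \<inter> S = {}" "\<phi> \<in> test_functions (T \<union> S)" using disj \<phi> by (auto simp: Un_commute)
    then show "(LINT x|lebesgue_on (S \<union> T). f x * vector_derivative \<phi> (at x))
        = - (LINT x|lebesgue_on (S \<union> T). g x * \<phi> x)"
      using part[OF S T(1) disj \<phi> w(1)] part[OF T S(1) _ _ w(2)]
      by (simp add: LINT_lebesgue_on_Un[OF ST disj])
  qed
qed

lemma weak_deriv_unique_Un:
  assumes "c < d" "d \<le> c'" "c' < d'"
    and "weak_deriv ({c<..<d} \<union> {c'<..<d'}) f g" "weak_deriv ({c<..<d} \<union> {c'<..<d'}) f h"
  shows "ae_eq ({c<..<d} \<union> {c'<..<d'}) g h"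
proof -
  let ?A = "{c<..<d}" and ?B = "{c'<..<d'}"
  have AB: "?A \<in> sets lebesgue" "?B \<in> sets lebesgue" "?A \<inter> ?B = {}" using assms(2) by auto
  have AB': "?A \<union> ?B \<in> sets lebesgue" by auto
  have restr: "weak_deriv ?A f k \<and> weak_deriv ?B f k" if "weak_deriv (?A \<union> ?B) f k" for k
  proof -
    have "f \<in> Lsq (?A \<union> ?B)" "k \<in> Lsq (?A \<union> ?B)" using that by (auto simp: weak_deriv_def)
    then show ?thesis
      using AB unfolding Lsq_Un[OF AB] by (auto intro!: weak_deriv_subset[OF that _ AB'])
  qed
  have refl: "ae_eq S f f" for S by (simp add: ae_eq_def)
  show ?thesis
    unfolding ae_eq_Un[OF AB(1,2)]
    using restr[OF assms(4)] restr[OF assms(5)] assms(1,3)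
    by (blast intro: weak_deriv_unique refl)
qed

lemma weak_deriv_wderiv: "weak_deriv S f g \<Longrightarrow> weak_deriv S f (wderiv S f)"
  unfolding wderiv_def by (rule someI[of "weak_deriv S f"])

text \<open>Uniqueness is a hypothesis here so that the lemma serves single intervals and the
  two-component set \<open>J\<close> alike. The chosen derivative equals \<open>g\<close> only
  almost everywhere, and \<open>weak_deriv_cong\<close> carries \<open>h\<close> over to it.\<close>

lemma wderiv_wderiv:
  assumes uniq: "\<forall>f g h. weak_deriv S f g \<longrightarrow> weak_deriv S f h \<longrightarrow> ae_eq S g h"
    and fg: "weak_deriv S f g" and gh: "weak_deriv S g h"
  shows "ae_eq S (wderiv S f) g" "weak_deriv S (wderiv S f) h" "ae_eq S (wderiv S (wderiv S f)) h"
    "f \<in> H2 S"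
proof -
  note w = weak_deriv_wderiv[OF fg]
  show ae: "ae_eq S (wderiv S f) g" using uniq w fg by blast
  show h: "weak_deriv S (wderiv S f) h"
    using w gh ae by (intro weak_deriv_cong[OF gh]) (auto simp: weak_deriv_def ae_eq_def eq_commute)
  show "ae_eq S (wderiv S (wderiv S f)) h" using uniq weak_deriv_wderiv[OF h] h by blast
  show "f \<in> H2 S" using fg h by (auto simp: H2_def H1_def)
qed

subsection \<open>The range of the operator\<close>

lemma A_range_imp_compatible:
  assumes L: "L1 < L2" and range: "U0 \<in> A_range L1 L2 L3 a b m k \<tau>"
  shows "(LINT x|lebesgue_on {L1<..<L2}. theta U0 x)
           + m *\<^sub>R (bdry_trace L1 L2 (u1 U0) L2 - bdry_trace L1 L2 (u1 U0) L1) = 0"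
proof -
  let ?I = "{L1<..<L2}" and ?tr = "bdry_trace L1 L2"
  obtain U where U: "U \<in> A_dom L1 L2 L3 a b m" "state_eq L1 L2 L3 (A_op L1 L2 L3 a b m k \<tau> U) U0"
    and U0: "U0 \<in> state_space L1 L2 L3"
    using range by (auto simp: A_range_def)
  have "q U \<in> H1 ?I" "u2 U \<in> H1 ?I" and q0: "?tr (q U) L1 = 0" "?tr (q U) L2 = 0"
    using U(1) by (auto simp: A_dom_def I_dom_def)
  then obtain gq gu where gq: "weak_deriv ?I (q U) gq" and gu: "weak_deriv ?I (u2 U) gu"
    by (auto simp: H1_def)
  let ?W = "\<lambda>y. k *\<^sub>R q U y + m *\<^sub>R u2 U y"
  define D where "D = wderiv ?I ?W"
  have "weak_deriv ?I ?W (\<lambda>y. k *\<^sub>R gq y + m *\<^sub>R gu y)"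
    by (intro weak_deriv_add weak_deriv_scale gq gu) auto
  then have D: "weak_deriv ?I ?W D"
    unfolding D_def by (rule weak_deriv_wderiv)
  then have DL: "D \<in> Lsq ?I" by (simp add: weak_deriv_def)
  have \<theta>: "theta U0 \<in> Lsq ?I" using U0 by (simp add: state_space_def I_dom_def)
  have ae\<theta>: "ae_eq ?I (\<lambda>x. - D x) (theta U0)" and aeu: "ae_eq ?I (u2 U) (u1 U0)"
    using U(2) by (auto simp: state_eq_def A_op_def Let_def I_dom_def D_def)
  have "(LINT x|lebesgue_on ?I. theta U0 x) = (LINT x|lebesgue_on ?I. - D x)"
    using ae\<theta> Lsq_measurable[OF DL] Lsq_measurable[OF \<theta>]
    by (intro integral_cong_AE) (auto simp: ae_eq_def eq_commute)
  also have "\<dots> = - integral {L1..L2} D"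
  proof -
    have "integrable (lebesgue_on ?I) D" using DL by (intro Lsq_integrable) auto
    then show ?thesis
      by (simp add: lebesgue_integral_eq_integral integral_open_interval_real)
  qed
  also have "integral {L1..L2} D = ?tr ?W L2 - ?tr ?W L1"
    using weak_deriv_trace(3)[OF D L, of L2] L by simp
  \<comment> \<open>The combination of the traces is a continuous representative of
    \<open>?W\<close>, which determines the trace.\<close>
  also have "?tr ?W x = k *\<^sub>R ?tr (q U) x + m *\<^sub>R ?tr (u2 U) x" if "x \<in> {L1..L2}" for x
  proof (rule bdry_trace_eq[OF L _ _ that])
    show "continuous_on {L1..L2} (\<lambda>x. k *\<^sub>R ?tr (q U) x + m *\<^sub>R ?tr (u2 U) x)"
      by (intro continuous_intros weak_deriv_trace(1)[OF gq L] weak_deriv_trace(1)[OF gu L])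
    show "ae_eq ?I (\<lambda>x. k *\<^sub>R ?tr (q U) x + m *\<^sub>R ?tr (u2 U) x) ?W"
      using weak_deriv_trace(2)[OF gq L] weak_deriv_trace(2)[OF gu L]
      unfolding ae_eq_def by eventually_elim simp
  qed
  then have "?tr ?W L2 - ?tr ?W L1 = m *\<^sub>R (?tr (u1 U0) L2 - ?tr (u1 U0) L1)"
    using L q0 bdry_trace_cong[OF aeu] by (simp add: scaleR_diff_right)
  finally show ?thesis by simp
qed

lemma compatible_imp_A_range:
  assumes L: "0 < L1" "L1 < L2" "L2 < L3"
    and par: "a > 0" "b > 0" "m > 0" "k > 0" "\<tau> > 0"
    and U0: "U0 \<in> state_space L1 L2 L3"
    and compat: "(LINT x|lebesgue_on {L1<..<L2}. theta U0 x)
           + m *\<^sub>R (bdry_trace L1 L2 (u1 U0) L2 - bdry_trace L1 L2 (u1 U0) L1) = 0"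
  shows "U0 \<in> A_range L1 L2 L3 a b m k \<tau>"
proof -
  let ?I = "{L1<..<L2}" and ?A = "{0<..<L1}" and ?B = "{L2<..<L3}" and ?tr = "bdry_trace L1 L2"
  let ?J = "?A \<union> ?B"
  have AB: "?A \<in> sets lebesgue" "?B \<in> sets lebesgue" "?A \<inter> ?B = {}" using L by auto
  have uniq: "\<forall>f g h. weak_deriv {c<..<d} f g \<longrightarrow> weak_deriv {c<..<d} f h \<longrightarrow> ae_eq {c<..<d} g h"
    if "c < d" for c d
    using that by (blast intro: weak_deriv_unique ae_eqI)
  have uniqI: "ae_eq ?I g h" if "weak_deriv ?I f g" "weak_deriv ?I f h" for f g h
    using uniq[OF L(2)] that by blast
  have uniqJ: "\<forall>f g h. weak_deriv ?J f g \<longrightarrow> weak_deriv ?J f h \<longrightarrow> ae_eq ?J g h"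
    using L by (auto intro!: weak_deriv_unique_Un)

  have fH: "u1 U0 \<in> H1 ?I" and vH: "v1 U0 \<in> H1_J L1 L2 L3" "v1 U0 \<in> H1 ?A" "v1 U0 \<in> H1 ?B"
    and \<theta>: "theta U0 \<in> Lsq ?I" and qL: "q U0 \<in> Lsq ?I" and uL: "u2 U0 \<in> Lsq ?I"
    and vL: "v2 U0 \<in> Lsq ?J"
    using U0 by (auto simp: state_space_def I_dom_def J_dom_def H1_J_def)
  have fL: "u1 U0 \<in> Lsq ?I" and v1L: "v1 U0 \<in> Lsq ?J"
    using fH vH(2,3) unfolding Lsq_Un[OF AB] by (auto simp: H1_def weak_deriv_def)
  obtain f' where f': "weak_deriv ?I (u1 U0) f'" using fH by (auto simp: H1_def)

  \<comment> \<open>\<open>R\<close> is what \<open>k *\<^sub>R q + m *\<^sub>R u2\<close> has to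
    be: its derivative is \<open>- theta U0\<close>, and its value at \<open>L1\<close> forces
    \<open>q\<close> to vanish there.\<close>
  define R where "R = (\<lambda>x. m *\<^sub>R ?tr (u1 U0) L1 + integral {L1..x} (\<lambda>x. (- 1) *\<^sub>R theta U0 x))"
  have n\<theta>: "(\<lambda>x. (- 1) *\<^sub>R theta U0 x) \<in> Lsq ?I" by (intro Lsq_scale \<theta>)
  have R: "weak_deriv ?I R (\<lambda>x. (- 1) *\<^sub>R theta U0 x)"
    unfolding R_def by (rule weak_deriv_primitive[OF n\<theta>])
  define Q where "Q = (\<lambda>x. (1 / k) *\<^sub>R (R x + (- m) *\<^sub>R u1 U0 x))"
  have Q: "weak_deriv ?I Q (\<lambda>x. (1 / k) *\<^sub>R ((- 1) *\<^sub>R theta U0 x + (- m) *\<^sub>R f' x))"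
    unfolding Q_def by (intro weak_deriv_scale weak_deriv_add R f') auto
  then have QL: "Q \<in> Lsq ?I" by (simp add: weak_deriv_def)
  have Rk: "(\<lambda>y. k *\<^sub>R Q y + m *\<^sub>R u1 U0 y) = R"
    using par by (simp add: Q_def fun_eq_iff)
  have trQ: "?tr Q x = (1 / k) *\<^sub>R (R x + (- m) *\<^sub>R ?tr (u1 U0) x)" if "x \<in> {L1..L2}" for x
  proof (rule bdry_trace_eq[OF L(2) _ _ that])
    show "continuous_on {L1..L2} (\<lambda>x. (1 / k) *\<^sub>R (R x + (- m) *\<^sub>R ?tr (u1 U0) x))"
      unfolding R_def
      by (intro continuous_on_scaleR continuous_on_add continuous_on_const
          continuous_on_primitive[OF n\<theta>] weak_deriv_trace(1)[OF f' L(2)])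
    show "ae_eq ?I (\<lambda>x. (1 / k) *\<^sub>R (R x + (- m) *\<^sub>R ?tr (u1 U0) x)) Q"
      using weak_deriv_trace(2)[OF f' L(2)]
      unfolding ae_eq_def by eventually_elim (simp add: Q_def)
  qed
  have trQ0: "?tr Q L1 = 0" "?tr Q L2 = 0"
  proof -
    have "integrable (lebesgue_on ?I) (theta U0)" using \<theta> by (intro Lsq_integrable) auto
    then have "(LINT x|lebesgue_on ?I. theta U0 x) = integral {L1..L2} (theta U0)"
      by (simp add: lebesgue_integral_eq_integral integral_open_interval_real)
    \<comment> \<open>By compatibility \<open>R L2\<close> equals \<open>m\<close> times the trace
      of \<open>u1 U0\<close> at \<open>L2\<close>, so \<open>Q\<close> vanishes there too.\<close>
    then have "integral {L1..L2} (theta U0) = - (m *\<^sub>R (?tr (u1 U0) L2 - ?tr (u1 U0) L1))"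
      using compat by (simp add: eq_neg_iff_add_eq_0)
    then show "?tr Q L1 = 0" "?tr Q L2 = 0"
      using L by (auto simp: trQ R_def scaleR_diff_right)
  qed

  \<comment> \<open>\<open>Z\<close> is the second derivative required of \<open>v1\<close>.
    \<open>P\<close> is the stress \<open>a u1_x - m theta\<close>, normalised to 0 at
    \<open>L1\<close>. The constants give \<open>WA L1 = 0\<close> and
    \<open>b *\<^sub>R WB L2 = P L2\<close>, the two flux conditions.\<close>
  define Z where "Z = (\<lambda>x. (1 / b) *\<^sub>R v2 U0 x)"
  have Z: "Z \<in> Lsq ?J" "Z \<in> Lsq ?A" "Z \<in> Lsq ?B"
    using vL unfolding Z_def Lsq_Un[OF AB] by (auto intro: Lsq_scale)
  define P where "P = (\<lambda>x. 0 + integral {L1..x} (u2 U0))"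
  define WA where "WA = (\<lambda>x. - integral {0..L1} Z + integral {0..x} Z)"
  define WB where "WB = (\<lambda>x. (1 / b) *\<^sub>R P L2 + integral {L2..x} Z)"
  have cP: "continuous_on {L1..L2} P" and cWA: "continuous_on {0..L1} WA"
    and cWB: "continuous_on {L2..L3} WB"
    unfolding P_def WA_def WB_def by (intro continuous_on_primitive uL Z)+
  have P: "weak_deriv ?I P (u2 U0)" and WA: "weak_deriv ?A WA Z" and WB: "weak_deriv ?B WB Z"
    unfolding P_def WA_def WB_def by (intro weak_deriv_primitive uL Z)+
  have WAL: "WA \<in> Lsq ?A" and WBL: "WB \<in> Lsq ?B"
    using WA WB by (auto simp: weak_deriv_def)
  \<comment> \<open>The constants give \<open>VA 0 = 0\<close> and \<open>VB L3 = 0\<close>.\<close>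
  define VA where "VA = (\<lambda>x. 0 + integral {0..x} WA)"
  define VB where "VB = (\<lambda>x. - integral {L2..L3} WB + integral {L2..x} WB)"
  have cVA: "continuous_on {0..L1} VA" and cVB: "continuous_on {L2..L3} VB"
    unfolding VA_def VB_def by (intro continuous_on_primitive WAL WBL)+
  have VA: "weak_deriv ?A VA WA" and VB: "weak_deriv ?B VB WB"
    unfolding VA_def VB_def by (intro weak_deriv_primitive WAL WBL)+
  \<comment> \<open>Any cut between the components would separate them; \<open>x \<le> L1\<close> is
    the one used in \<open>bdry_trace_J\<close>.\<close>
  define glue :: "(real \<Rightarrow> complex) \<Rightarrow> (real \<Rightarrow> complex) \<Rightarrow> real \<Rightarrow> complex"
    where "glue = (\<lambda>g h x. if x \<le> L1 then g x else h x)"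
  have glue_A: "ae_eq ?A g (glue g h)" "h \<in> Lsq ?A \<Longrightarrow> glue h h' \<in> Lsq ?A"
    and glue_B: "ae_eq ?B h (glue g h)" "h \<in> Lsq ?B \<Longrightarrow> glue g h \<in> Lsq ?B" for g h h'
    using L Lsq_cong[of ?A "glue h h'" h] Lsq_cong[of ?B "glue g h" h]
    by (auto intro!: ae_eqI simp: glue_def)
  define V where "V = glue VA VB"
  define W where "W = glue WA WB"
  have VLA: "VA \<in> Lsq ?A" and VLB: "VB \<in> Lsq ?B" using VA VB by (auto simp: weak_deriv_def)
  have refl: "ae_eq S h h" for S h by (simp add: ae_eq_def)
  have VW: "weak_deriv ?A V W" "weak_deriv ?B V W" and WZ: "weak_deriv ?A W Z" "weak_deriv ?B W Z"
    unfolding V_def W_def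
    by (rule weak_deriv_cong[OF VA] weak_deriv_cong[OF VB] weak_deriv_cong[OF WA] weak_deriv_cong[OF WB];
        intro glue_A glue_B VLA VLB WAL WBL Z refl)+
  have VWJ: "weak_deriv ?J V W" and WZJ: "weak_deriv ?J W Z"
    using VW WZ AB(3) by (auto intro!: weak_deriv_Un)
  note ddV = wderiv_wderiv[OF uniqJ VWJ WZJ]

  \<comment> \<open>The derivative of \<open>theta\<close>, solved from the fourth component of the
    equation.\<close>
  define p where "p = (\<lambda>x. (- 1 / k) *\<^sub>R (\<tau> *\<^sub>R q U0 x + Q x))"
  have pL: "p \<in> Lsq ?I" unfolding p_def by (intro Lsq_scale Lsq_add qL QL)
  define G where "G = (\<lambda>x. 0 + integral {L1..x} p)"
  \<comment> \<open>\<open>C0\<close> solves \<open>integral {L1..L2} P + m *\<^sub>R ((L2 - L1)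
    *\<^sub>R C0 + integral {L1..L2} G) = a *\<^sub>R (VB L2 - VA L1)\<close>, so that the integral
    of \<open>w\<close> bridges the gap between \<open>VA L1\<close> and
    \<open>VB L2\<close>.\<close>
  define C0 where "C0 = (a *\<^sub>R (VB L2 - VA L1) - integral {L1..L2} P - m *\<^sub>R integral {L1..L2} G) /\<^sub>R (m * (L2 - L1))"
  define T where "T = (\<lambda>x. C0 + integral {L1..x} p)"
  have TG: "T = (\<lambda>x. C0 + G x)" by (simp add: T_def G_def)
  have cG: "continuous_on {L1..L2} G" and cT: "continuous_on {L1..L2} T"
    unfolding G_def T_def by (intro continuous_on_primitive pL)+
  have T: "weak_deriv ?I T p" unfolding T_def by (rule weak_deriv_primitive[OF pL])
  \<comment> \<open>The derivative of \<open>u1\<close>, from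
    \<open>a *\<^sub>R w x - m *\<^sub>R T x = P x\<close>.\<close>
  define w where "w = (\<lambda>x. (1 / a) *\<^sub>R (P x + m *\<^sub>R T x))"
  have cw: "continuous_on {L1..L2} w"
    unfolding w_def by (intro continuous_intros cP cT)
  have w: "weak_deriv ?I w (\<lambda>x. (1 / a) *\<^sub>R (u2 U0 x + m *\<^sub>R p x))"
    unfolding w_def by (intro weak_deriv_scale weak_deriv_add P T) auto
  then have wL: "w \<in> Lsq ?I" by (simp add: weak_deriv_def)
  have int_w: "integral {L1..L2} w = VB L2 - VA L1"
  proof -
    have "(P has_integral integral {L1..L2} P) {L1..L2}" "(G has_integral integral {L1..L2} G) {L1..L2}"
      using cP cG by (auto intro: integrable_integral integrable_continuous_real)
    moreover have "((\<lambda>x. C0) has_integral (L2 - L1) *\<^sub>R C0) {L1..L2}"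
      using has_integral_const_real[of C0 L1 L2] L by simp
    ultimately have "integral {L1..L2} w
        = (1 / a) *\<^sub>R (integral {L1..L2} P + m *\<^sub>R ((L2 - L1) *\<^sub>R C0 + integral {L1..L2} G))"
      unfolding w_def TG
      by (intro integral_unique has_integral_cmul Henstock_Kurzweil_Integration.has_integral_add)
    also have "m *\<^sub>R ((L2 - L1) *\<^sub>R C0 + integral {L1..L2} G)
        = a *\<^sub>R (VB L2 - VA L1) - integral {L1..L2} P"
    proof -
      have "(m * (L2 - L1)) *\<^sub>R C0
          = a *\<^sub>R (VB L2 - VA L1) - integral {L1..L2} P - m *\<^sub>R integral {L1..L2} G"
      proof -
        have "m * (L2 - L1) \<noteq> 0" using par L by simp
        from right_inverse[OF this] show ?thesis
          unfolding C0_def scaleR_scaleR by (simp only: scaleR_one)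
      qed
      then show ?thesis by (simp add: scaleR_add_right)
    qed
    finally show ?thesis using par by simp
  qed
  define Y where "Y = (\<lambda>x. VA L1 + integral {L1..x} w)"
  have Y: "weak_deriv ?I Y w" unfolding Y_def by (rule weak_deriv_primitive[OF wL])
  note ddY = wderiv_wderiv[OF uniq[OF L(2)] Y w]
  have trY: "?tr Y L1 = VA L1" "?tr Y L2 = VB L2"
    using L int_w unfolding Y_def by (auto simp: bdry_trace_primitive[OF wL L(2)])
  \<comment> \<open>On each component the chosen derivative on \<open>?J\<close> agrees almost
    everywhere with \<open>WA\<close> or \<open>WB\<close>, which are continuous up to the
    boundary.\<close>
  have trV: "bdry_trace_J L1 L2 L3 V x = (if x \<le> L1 then VA x else VB x)"
    and trW: "bdry_trace_J L1 L2 L3 (wderiv ?J V) x = (if x \<le> L1 then WA x else WB x)"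
    if "x \<in> {0..L1} \<union> {L2..L3}" for x
  proof -
    have "ae_eq ?A WA (wderiv ?J V)" "ae_eq ?B WB (wderiv ?J V)"
      using ddV(1) glue_A(1)[of WA WB] glue_B(1)[of WB WA]
      unfolding ae_eq_Un[OF AB(1,2)] W_def[symmetric] by (meson ae_eq_trans ae_eq_sym)+
    then show "bdry_trace_J L1 L2 L3 V x = (if x \<le> L1 then VA x else VB x)"
      "bdry_trace_J L1 L2 L3 (wderiv ?J V) x = (if x \<le> L1 then WA x else WB x)"
      using that L unfolding bdry_trace_J_def V_def
      by (auto intro!: bdry_trace_eq cVA cVB cWA cWB glue_A glue_B)
  qed
  have trw: "?tr (wderiv ?I Y) x = w x" and trT: "?tr T x = T x" if "x \<in> {L1..L2}" for x
    using that by (auto intro!: bdry_trace_eq L cw cT ae_eq_sym[OF ddY(1)] refl)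

  define U where "U = \<lparr>u1 = Y, v1 = V, theta = T, q = Q, u2 = u1 U0, v2 = v1 U0\<rparr>"
  \<comment> \<open>\<open>H2_J\<close> refers to the derivatives chosen on each component, not to
    the one chosen on \<open>?J\<close>, hence separate applications.\<close>
  have VH: "V \<in> H2 ?A" "V \<in> H2 ?B"
    using wderiv_wderiv(4)[OF uniq[OF L(1)] VW(1) WZ(1)]
      wderiv_wderiv(4)[OF uniq[OF L(3)] VW(2) WZ(2)] by auto
  have H1s: "Y \<in> H1 ?I" "T \<in> H1 ?I" "Q \<in> H1 ?I" "V \<in> H1 ?A" "V \<in> H1 ?B"
    and Ls: "T \<in> Lsq ?I"
    using Y T Q VW by (auto simp: H1_def weak_deriv_def)
  have space: "U \<in> state_space L1 L2 L3"
    using H1s Ls QL fL v1L L trV trY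
    by (auto simp: state_space_def U_def I_dom_def J_dom_def H1_J_def VA_def VB_def)
  have flux: "a *\<^sub>R ?tr (wderiv ?I Y) x - m *\<^sub>R ?tr T x = b *\<^sub>R bdry_trace_J L1 L2 L3 (wderiv ?J V) x"
    if "x \<in> {L1, L2}" for x
  proof -
    have "a *\<^sub>R ?tr (wderiv ?I Y) x - m *\<^sub>R ?tr T x = P x"
      using that L par by (auto simp: trw trT w_def)
    moreover have "b *\<^sub>R bdry_trace_J L1 L2 L3 (wderiv ?J V) x = P x"
      using that L par by (auto simp: trW WA_def WB_def P_def)
    ultimately show ?thesis by simp
  qed
  have dom: "U \<in> A_dom L1 L2 L3 a b m"
    using space ddY(4) VH H1s fH vH flux trQ0 U0
    by (auto simp: A_dom_def U_def I_dom_def J_dom_def H2_J_def state_space_def)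
  have "state_eq L1 L2 L3 (A_op L1 L2 L3 a b m k \<tau> U) U0"
  proof -
    have "ae_eq ?I (wderiv ?I R) (\<lambda>x. (- 1) *\<^sub>R theta U0 x)"
      by (rule uniqI[OF weak_deriv_wderiv[OF R] R])
    then have 1: "ae_eq ?I (\<lambda>x. - wderiv ?I (\<lambda>y. k *\<^sub>R Q y + m *\<^sub>R u1 U0 y) x) (theta U0)"
      unfolding Rk ae_eq_def by eventually_elim simp
    have "ae_eq ?I (wderiv ?I T) p"
      by (rule uniqI[OF weak_deriv_wderiv[OF T] T])
    then have 2: "ae_eq ?I (\<lambda>x. - (k / \<tau>) *\<^sub>R wderiv ?I T x - (1 / \<tau>) *\<^sub>R Q x) (q U0)"
      unfolding ae_eq_def by eventually_elim (use par in \<open>simp add: p_def scaleR_add_right scaleR_diff_right\<close>)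
    \<comment> \<open>\<open>?S\<close> contains the chosen derivative of \<open>Y\<close> and so
      equals \<open>P\<close> only almost everywhere; the weak derivative \<open>u2 U0\<close> is
      transferred from \<open>P\<close>.\<close>
    let ?S = "\<lambda>y. a *\<^sub>R wderiv ?I Y y - m *\<^sub>R T y"
    have aeS: "ae_eq ?I P ?S"
      using ddY(1) unfolding ae_eq_def by eventually_elim (use par in \<open>simp add: w_def\<close>)
    have "(\<lambda>y. a *\<^sub>R wderiv ?I Y y + (- m) *\<^sub>R T y) \<in> Lsq ?I"
      using ddY(2) by (intro Lsq_add Lsq_scale Ls) (simp add: weak_deriv_def)
    then have S: "weak_deriv ?I ?S (u2 U0)"
      using aeS by (intro weak_deriv_cong[OF P] uL refl) auto
    have 3: "ae_eq ?I (wderiv ?I ?S) (u2 U0)"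
      by (rule uniqI[OF weak_deriv_wderiv[OF S] S])
    have 4: "ae_eq ?J (\<lambda>x. b *\<^sub>R wderiv ?J (wderiv ?J V) x) (v2 U0)"
      using ddV(3) unfolding ae_eq_def by eventually_elim (use par in \<open>simp add: Z_def\<close>)
    show ?thesis
      using 1 2 3 4 by (simp add: state_eq_def A_op_def Let_def U_def I_dom_def J_dom_def refl)
  qed
  then show ?thesis using dom U0 by (auto simp: A_range_def)
qed

theorem proposition3p1:
  fixes L1 L2 L3 a b m k \<tau> :: real and U0 :: state
  assumes "0 < L1" and "L1 < L2" and "L2 < L3"
    and "a > 0" and "b > 0" and "m > 0" and "k > 0" and "\<tau> > 0"
    and "U0 \<in> state_space L1 L2 L3"
  shows "(LINT x|lebesgue_on {L1<..<L2}. theta U0 x)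
           + m *\<^sub>R (bdry_trace L1 L2 (u1 U0) L2 - bdry_trace L1 L2 (u1 U0) L1) = 0
         \<longleftrightarrow> U0 \<in> A_range L1 L2 L3 a b m k \<tau>"
  using A_range_imp_compatible[OF assms(2)] compatible_imp_A_range[OF assms] by blast

end
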